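(* Suppose that $0<p<1$ and $1\le d\le\infty$, and let $\Gamma$ be a nonempty subset of $\mathbb{N}_0^{(d)}$. Then the idempotent coefficient multiplier $P_\Gamma$, defined on analytic polynomials by $$P_\Gamma:\ \sum_{\alpha\in\mathbb{N}_0^{(d)}}c_\alpha z^\alpha\ \mapsto\ \sum_{\alpha\in\Gamma}c_\alpha z^\alpha,$$ extends to a contraction on $H^p(\mathbb{T}^d)$ if and only if there exists a subset $J\subseteq\{1,2,\ldots,d\}$ ($J\subseteq\{1,2,\ldots\}$ if $d=\infty$) such that $$\Gamma=\{\alpha\in\mathbb{N}_0^{(d)}:\ \alpha_j=0\ \text{for}\ j\in J\}.$$
   Context: $\mathbb{T}^d$ is the $d$-dimensional torus (the countably infinite product of unit circles when $d=\infty$) with its normalized Haar measure $m_d$. $\mathbb{N}_0=\{0,1,2,\ldots\}$ and $\mathbb{N}_0^{(d)}=\bigoplus_{j=1}^d\mathbb{N}_0$ (finitely supported sequences when $d=\infty$). For $z=(z_j)\in\mathbb{T}^d$ and $\alpha=(\alpha_j)\in\mathbb{N}_0^{(d)}$, $z^\alpha=\prod_j z_j^{\alpha_j}$. Analytic polynomials are finite complex linear combinations of the $z^\alpha$, $\alpha\in\mathbb{N}_0^{(d)}$. $H^p(\mathbb{T}^d)$ is the closure of the analytic polynomials in $L^p(\mathbb{T}^d)$, with quasi-norm $\|f\|_p=(\int_{\mathbb T^d}|f|^p\,dm_d)^{1/p}$. "$P_\Gamma$ extends to a contraction" means $\|P_\Gamma f\|_p\le\|f\|_p$ for all analytic polynomials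 $f$. *)

theory Defs
  imports "HOL-Probability.Probability" "HOL-Library.Poly_Mapping" "HOL-Library.Extended_Nat"
begin

(* The coordinates 1, ..., d, or all positive integers if d is infinite. *)
definition coords :: "enat \<Rightarrow> nat set" where
  "coords d = {j. 1 \<le> j \<and> enat j \<le> d}"

definition circle_measure :: "complex measure" where
  "circle_measure =
     distr (uniform_measure lborel {0..2 * pi}) (restrict_space borel (sphere 0 1)) cis"

(* Points of the torus are extensional families on coords d. For infinite d the countable product
   sigma-algebra is the Borel sigma-algebra of the product topology, so that the product
   measure is the normalized Haar measure in that case as well. *)
definition torus :: "enat \<Rightarrow> (nat \<Rightarrow> complex) measure" where
  "torus d = Pi\<^sub>M (coords d) (\<lambda>_. circle_measure)"

definition multi_indices :: "enat \<Rightarrow> (nat \<Rightarrow>\<^sub>0 nat) set" where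
  "multi_indices d = {\<alpha>. Poly_Mapping.keys \<alpha> \<subseteq> coords d}"

definition monomial :: "(nat \<Rightarrow>\<^sub>0 nat) \<Rightarrow> (nat \<Rightarrow> complex) \<Rightarrow> complex" where
  "monomial \<alpha> z = (\<Prod>j\<in>Poly_Mapping.keys \<alpha>. z j ^ Poly_Mapping.lookup \<alpha> j)"

(* An analytic polynomial is represented by its finitely supported coefficient family, which is
   determined by the corresponding function on the torus (orthogonality of the monomials). *)
definition analytic_polys :: "enat \<Rightarrow> ((nat \<Rightarrow>\<^sub>0 nat) \<Rightarrow>\<^sub>0 complex) set" where
  "analytic_polys d = {f. Poly_Mapping.keys f \<subseteq> multi_indices d}"

definition eval_poly :: "((nat \<Rightarrow>\<^sub>0 nat) \<Rightarrow>\<^sub>0 complex) \<Rightarrow> (nat \<Rightarrow> complex) \<Rightarrow> complex" where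
  "eval_poly f z = (\<Sum>\<alpha>\<in>Poly_Mapping.keys f. Poly_Mapping.lookup f \<alpha> * monomial \<alpha> z)"

definition Lp_quasinorm :: "enat \<Rightarrow> real \<Rightarrow> ((nat \<Rightarrow> complex) \<Rightarrow> complex) \<Rightarrow> real" where
  "Lp_quasinorm d p F = (LINT z|torus d. norm (F z) powr p) powr (1 / p)"

definition idempotent_multiplier ::
  "(nat \<Rightarrow>\<^sub>0 nat) set \<Rightarrow> ((nat \<Rightarrow>\<^sub>0 nat) \<Rightarrow>\<^sub>0 complex) \<Rightarrow> ((nat \<Rightarrow>\<^sub>0 nat) \<Rightarrow>\<^sub>0 complex)" where
  "idempotent_multiplier \<Gamma> f = (\<Sum>\<alpha>\<in>Poly_Mapping.keys f \<inter> \<Gamma>.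
     Poly_Mapping.single \<alpha> (Poly_Mapping.lookup f \<alpha>))"

(* The analytic polynomials are dense in the Hardy space by definition, so the inequality on them
   is what it means for the multiplier to extend to a contraction. *)
definition extends_to_contraction ::
  "enat \<Rightarrow> real \<Rightarrow>
    (((nat \<Rightarrow>\<^sub>0 nat) \<Rightarrow>\<^sub>0 complex) \<Rightarrow> ((nat \<Rightarrow>\<^sub>0 nat) \<Rightarrow>\<^sub>0 complex)) \<Rightarrow> bool" where
  "extends_to_contraction d p P \<longleftrightarrow>
     (\<forall>f\<in>analytic_polys d.
        Lp_quasinorm d p (eval_poly (P f)) \<le> Lp_quasinorm d p (eval_poly f))"

lemma prob_space_circle_measure: "prob_space circle_measure"
proof -
  interpret U: prob_space "uniform_measure lborel {0..2 * pi}"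
    by (rule prob_space_uniform_measure) auto
  have "cis \<in> measurable (uniform_measure lborel {0..2 * pi}) (restrict_space borel (sphere 0 1))"
    by (intro measurable_restrict_space2) (auto intro!: borel_measurable_continuous_onI
          continuous_intros simp: measurable_cong_sets[OF sets_uniform_measure refl])
  then show ?thesis
    unfolding circle_measure_def by (rule U.prob_space_distr)
qed

lemma prob_space_torus: "prob_space (torus d)"
  unfolding torus_def by (intro prob_space_PiM prob_space_circle_measure)

lemma space_torus: "space (torus d) = Pi\<^sub>E (coords d) (\<lambda>_. sphere 0 1)"
  by (simp add: torus_def space_PiM circle_measure_def space_restrict_space)

lemma lookup_idempotent_multiplier:
  "Poly_Mapping.lookup (idempotent_multiplier \<Gamma> f) \<alpha> =
    (if \<alpha> \<in> \<Gamma> then Poly_Mapping.lookup f \<alpha> else 0)"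
  by (auto simp: idempotent_multiplier_def lookup_sum lookup_single when_def in_keys_iff
      sum.delta)

lemma eval_poly_measurable:
  assumes "f \<in> analytic_polys d"
  shows "eval_poly f \<in> borel_measurable (torus d)"
proof -
  have c: "(\<lambda>z. z j) \<in> borel_measurable (torus d)" if "j \<in> coords d" for j
  proof -
    have "(\<lambda>z. z j) \<in> measurable (torus d) circle_measure"
      unfolding torus_def using that by (rule measurable_component_singleton)
    then have "(\<lambda>z. z j) \<in> measurable (torus d) (restrict_space borel (sphere 0 1))"
      by (simp add: circle_measure_def cong: measurable_cong_sets)
    then show ?thesis by (simp add: measurable_restrict_space2_iff)
  qed
  show ?thesis
    unfolding eval_poly_def[abs_def] monomial_def using assms c
    by (intro borel_measurable_sum borel_measurable_times borel_measurable_const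
        borel_measurable_prod borel_measurable_power)
      (auto simp: analytic_polys_def multi_indices_def)
qed

lemma eval_poly_bounded:
  assumes "f \<in> analytic_polys d" "z \<in> space (torus d)"
  shows "norm (eval_poly f z) \<le> (\<Sum>\<alpha>\<in>Poly_Mapping.keys f. norm (Poly_Mapping.lookup f \<alpha>))"
proof -
  have "norm (monomial \<alpha> z) = 1" if "\<alpha> \<in> Poly_Mapping.keys f" for \<alpha>
    using that assms by (auto simp: monomial_def analytic_polys_def multi_indices_def
        space_torus norm_power PiE_iff subset_iff prod_norm[symmetric] intro!: prod.neutral)
  then have "norm (Poly_Mapping.lookup f \<alpha> * monomial \<alpha> z) = norm (Poly_Mapping.lookup f \<alpha>)"
    if "\<alpha> \<in> Poly_Mapping.keys f" for \<alpha>
    using that by (simp add: norm_mult)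
  then show ?thesis
    unfolding eval_poly_def by (intro order_trans[OF norm_sum]) simp
qed

(* Hence the Bochner integral in the quasi-norm never takes its default value on polynomials. *)
lemma integrable_eval_poly_powr:
  assumes "f \<in> analytic_polys d" "0 < p"
  shows "integrable (torus d) (\<lambda>z. norm (eval_poly f z) powr p)"
proof -
  interpret prob_space "torus d" by (rule prob_space_torus)
  note eval_poly_measurable[OF assms(1), measurable]
  show ?thesis
    by (rule integrable_const_bound
      [where B = "(\<Sum>\<alpha>\<in>Poly_Mapping.keys f. norm (Poly_Mapping.lookup f \<alpha>)) powr p"])
      (use assms eval_poly_bounded in \<open>auto intro!: AE_I2 powr_mono2\<close>)
qed

end

theory Submission
  imports Defs "HOL-Complex_Analysis.Complex_Analysis" "HOL-Real_Asymp.Real_Asymp"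
    "HOL-Computational_Algebra.Fundamental_Theorem_Algebra"
begin

text \<open>
  The measure on the torus is invariant under rotations of the coordinates, hence distinct monomials
  are orthogonal. If \<open>\<Gamma>\<close> consists of all indices vanishing on \<open>J\<close>, then \<open>P f (z)\<close> is the value at
  \<open>w = 0\<close> of the polynomial obtained from \<open>f\<close> by multiplying the coordinates in \<open>J\<close> by \<open>w\<close>, and the
  contraction property is subharmonicity of \<open>norm g powr p\<close> in the disc together with Fubini's theorem.

  Conversely, a contraction forces closure properties of \<open>\<Gamma>\<close>. Perturbing \<open>z\<^sup>a\<close> by
  \<open>\<epsilon> (z\<^sup>b + z\<^sup>c)\<close> with \<open>b + c = 2 a\<close> decreases the quasi-norm when \<open>p < 1\<close>, because then
  \<open>1 + \<epsilon> (w + cnj w)\<close> is real and \<open>x \<mapsto> x powr p\<close> is strictly concave; so \<open>b\<close> or \<open>c\<close> lies in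
  \<open>\<Gamma>\<close>. Perturbing \<open>z\<^sup>a + \<epsilon> (z\<^sup>b + z\<^sup>c)\<close> by a suitable multiple of \<open>z\<^sup>e\<close> with \<open>a + e = b + c\<close>
  also decreases it, because the first variation is
  \<open>\<epsilon>\<^sup>2 q (q - 1) / 2\<close> times a constant at least \<open>2\<close>, up to higher order, where \<open>q = p / 2\<close>; so
  \<open>e\<close> lies in \<open>\<Gamma>\<close>. Consequently \<open>\<Gamma>\<close> contains every \<open>b \<le> 2 a\<close> for \<open>a \<in> \<Gamma>\<close>, hence every index
  supported in the union of the supports of its elements.
\<close>

section \<open>Rotation invariance\<close>

lemma sets_circle_measure [measurable_cong]:
  "sets circle_measure = sets (restrict_space borel (sphere 0 1))"
  by (simp add: circle_measure_def)

lemma space_circle_measure: "space circle_measure = sphere 0 1"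
  by (simp add: circle_measure_def space_restrict_space)

lemma measurable_circle_measure_imp_borel:
  "f \<in> borel_measurable borel \<Longrightarrow> f \<in> borel_measurable circle_measure"
  using measurable_cong_sets[OF sets_circle_measure refl] measurable_restrict_space1 by blast

lemma nn_integral_circle_measure:
  assumes [measurable]: "f \<in> borel_measurable borel"
  shows "(\<integral>\<^sup>+ w. f w \<partial>circle_measure) =
    (\<integral>\<^sup>+ t. f (cis t) * indicator {0..2 * pi} t \<partial>lborel) / ennreal (2 * pi)"
proof -
  have [measurable]: "cis \<in> borel_measurable borel"
    by (intro borel_measurable_continuous_onI continuous_intros)
  have c: "cis \<in> measurable (uniform_measure lborel {0..2 * pi}) (restrict_space borel (sphere 0 1))"
    by (intro measurable_restrict_space2) (auto cong: measurable_cong_sets)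
  have "f \<in> borel_measurable (restrict_space borel (sphere 0 1))"
    by (rule measurable_restrict_space1) measurable
  then show ?thesis
    unfolding circle_measure_def
    by (simp add: nn_integral_distr[OF c] nn_integral_uniform_measure)
qed

text \<open>The substitution moves the window to \<open>{t..t + T}\<close>. By periodicity the
  overhang \<open>{T..t + T}\<close> contributes as much as the missing piece
  \<open>{0..t}\<close>.\<close>

lemma nn_integral_periodic_shift:
  fixes G :: "real \<Rightarrow> ennreal"
  assumes [measurable]: "G \<in> borel_measurable borel"
    and per: "\<And>x. G (x + T) = G x" and t: "0 \<le> t" "t \<le> T"
  shows "(\<integral>\<^sup>+ x. G (t + x) * indicator {0..T} x \<partial>lborel) = (\<integral>\<^sup>+ x. G x * indicator {0..T} x \<partial>lborel)"
proof -
  have AEne: "AE x in lborel. x \<noteq> c" for c :: real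
    by (rule AE_lborel_singleton)
  have "(\<integral>\<^sup>+ x. G x * indicator {t..t + T} x \<partial>lborel)
      = (\<integral>\<^sup>+ x. G (t + 1 * x) * indicator {t..t + T} (t + 1 * x) \<partial>lborel)"
    by (subst nn_integral_real_affine[where c = 1 and t = t]) auto
  also have "\<dots> = (\<integral>\<^sup>+ x. G (t + x) * indicator {0..T} x \<partial>lborel)"
    by (intro nn_integral_cong) (auto simp: indicator_def)
  finally have 1: "(\<integral>\<^sup>+ x. G (t + x) * indicator {0..T} x \<partial>lborel)
    = (\<integral>\<^sup>+ x. G x * indicator {t..t + T} x \<partial>lborel)" by simp
  have "(\<integral>\<^sup>+ x. G x * indicator {T..t + T} x \<partial>lborel)
      = (\<integral>\<^sup>+ x. G (T + 1 * x) * indicator {T..t + T} (T + 1 * x) \<partial>lborel)"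
    by (subst nn_integral_real_affine[where c = 1 and t = T]) auto
  also have "\<dots> = (\<integral>\<^sup>+ x. G x * indicator {0..t} x \<partial>lborel)"
    by (intro nn_integral_cong) (auto simp: indicator_def per add.commute[of T])
  finally have 2: "(\<integral>\<^sup>+ x. G x * indicator {T..t + T} x \<partial>lborel)
    = (\<integral>\<^sup>+ x. G x * indicator {0..t} x \<partial>lborel)" .
  have "(\<integral>\<^sup>+ x. G x * indicator {t..t + T} x \<partial>lborel)
     = (\<integral>\<^sup>+ x. G x * indicator {t..T} x + G x * indicator {T..t + T} x \<partial>lborel)"
    \<comment> \<open>The two pieces overlap only in the null set consisting of the point
      \<open>T\<close>.\<close>
    using AEne[of T] t by (intro nn_integral_cong_AE) (auto simp: indicator_def)
  also have "\<dots> = (\<integral>\<^sup>+ x. G x * indicator {t..T} x \<partial>lborel) + (\<integral>\<^sup>+ x. G x * indicator {0..t} x \<partial>lborel)"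
    by (simp add: nn_integral_add 2)
  also have "\<dots> = (\<integral>\<^sup>+ x. G x * indicator {t..T} x + G x * indicator {0..t} x \<partial>lborel)"
    by (simp add: nn_integral_add)
  also have "\<dots> = (\<integral>\<^sup>+ x. G x * indicator {0..T} x \<partial>lborel)"
    using AEne[of t] t by (intro nn_integral_cong_AE) (auto simp: indicator_def)
  finally show ?thesis using 1 by simp
qed

text \<open>In terms of the angle a rotation is a translation, and the integrand is periodic with
  period \<open>2 * pi\<close>.\<close>

lemma nn_integral_circle_measure_rotate:
  assumes [measurable]: "f \<in> borel_measurable borel" and "norm c = 1"
  shows "(\<integral>\<^sup>+ w. f (c * w) \<partial>circle_measure) = (\<integral>\<^sup>+ w. f w \<partial>circle_measure)"
proof -
  have [measurable]: "cis \<in> borel_measurable borel"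
    by (intro borel_measurable_continuous_onI continuous_intros)
  obtain t where t: "0 \<le> t" "t < 2 * pi" "c = cis t"
    using complex_unimodular_polar[OF assms(2)] by (metis cis.ctr complex_eq_iff cis.sel)
  have "(\<integral>\<^sup>+ x. f (c * cis x) * indicator {0..2 * pi} x \<partial>lborel)
    = (\<integral>\<^sup>+ x. f (cis (t + x)) * indicator {0..2 * pi} x \<partial>lborel)"
    by (simp add: t cis_mult)
  also have "\<dots> = (\<integral>\<^sup>+ x. f (cis x) * indicator {0..2 * pi} x \<partial>lborel)"
    using t by (intro nn_integral_periodic_shift[where G = "\<lambda>x. f (cis x)"])
      (auto simp: cis_mult[symmetric])
  finally show ?thesis by (simp add: nn_integral_circle_measure)
qed

lemma measurable_rotate_circle_measure [measurable]:
  assumes "norm c = 1"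
  shows "(\<lambda>w. c * w) \<in> measurable circle_measure circle_measure"
proof -
  have "(\<lambda>w. c * w) \<in> measurable circle_measure (restrict_space borel (sphere 0 1))"
    by (intro measurable_restrict_space2 measurable_circle_measure_imp_borel)
      (auto simp: space_circle_measure norm_mult assms)
  then show ?thesis by (simp add: sets_circle_measure cong: measurable_cong_sets)
qed

lemma emeasure_circle_measure_rotate:
  assumes "norm c = 1" and A: "A \<in> sets circle_measure"
  shows "emeasure circle_measure ((\<lambda>w. c * w) -` A \<inter> space circle_measure) = emeasure circle_measure A"
proof -
  note [measurable] = measurable_rotate_circle_measure[OF assms(1)]
  have [measurable]: "A \<in> sets borel"
    using A by (auto simp: sets_circle_measure sets_restrict_space)
  have "emeasure circle_measure ((\<lambda>w. c * w) -` A \<inter> space circle_measure)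
     = (\<integral>\<^sup>+ w. indicator A (c * w) \<partial>circle_measure)"
    using measurable_sets[OF measurable_rotate_circle_measure[OF assms(1)] A]
    by (subst nn_integral_indicator[symmetric])
       (auto intro!: nn_integral_cong simp del: nn_integral_indicator split: split_indicator)
  also have "\<dots> = (\<integral>\<^sup>+ w. indicator A w \<partial>circle_measure)"
    by (intro nn_integral_circle_measure_rotate assms) auto
  finally show ?thesis using A by simp
qed

text \<open>The restriction keeps the image extensional, as the points of \<open>torus d\<close>
  are.\<close>

definition rotate_torus :: "enat \<Rightarrow> (nat \<Rightarrow> complex) \<Rightarrow> (nat \<Rightarrow> complex) \<Rightarrow> nat \<Rightarrow> complex" where
  "rotate_torus d c z = (\<lambda>j\<in>coords d. c j * z j)"

lemma measurable_rotate_torus: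
  assumes "\<And>j. j \<in> coords d \<Longrightarrow> norm (c j) = 1"
  shows "rotate_torus d c \<in> measurable (torus d) (torus d)"
  unfolding rotate_torus_def[abs_def] torus_def
  by (intro measurable_restrict measurable_compose[OF measurable_component_singleton]
      measurable_rotate_circle_measure assms)

text \<open>Finite measures on the product agree once they agree on cylinders over finitely many
  coordinates. The preimage of a cylinder is again a cylinder, whose sides are the preimages of the
  original sides, so the circle case applies factor by factor.\<close>

lemma distr_rotate_torus:
  assumes c: "\<And>j. j \<in> coords d \<Longrightarrow> norm (c j) = 1"
  shows "distr (torus d) (torus d) (rotate_torus d c) = torus d"
proof -
  interpret P: product_prob_space "\<lambda>_. circle_measure" "coords d"
    by (intro product_prob_spaceI prob_space_circle_measure)
  interpret T: prob_space "torus d" by (rule prob_space_torus)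
  note m = measurable_rotate_torus[OF c]
  show ?thesis
    unfolding torus_def
  proof (rule measure_eqI_PiM_infinite)
    fix A :: "nat \<Rightarrow> complex set" and J
    assume J: "finite J" "J \<subseteq> coords d" and A: "\<And>j. j \<in> J \<Longrightarrow> A j \<in> sets circle_measure"
    let ?E = "\<lambda>B. prod_emb (coords d) (\<lambda>_. circle_measure) J (Pi\<^sub>E J B)"
    let ?B = "\<lambda>j. (\<lambda>w. c j * w) -` A j \<inter> space circle_measure"
    have B: "?B j \<in> sets circle_measure" if "j \<in> J" for j
      using J A[OF that] that c by (intro measurable_sets[OF measurable_rotate_circle_measure]) auto
    have "emeasure (distr (torus d) (torus d) (rotate_torus d c)) (?E A)
       = emeasure (torus d) (rotate_torus d c -` ?E A \<inter> space (torus d))"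
      using J A by (intro emeasure_distr m) (auto simp: torus_def intro!: sets_PiM_I)
    also have "rotate_torus d c -` ?E A \<inter> space (torus d) = ?E ?B"
      using J c
      by (auto simp: rotate_torus_def prod_emb_def space_torus space_PiM space_circle_measure PiE_iff
          extensional_def norm_mult subset_iff restrict_def split: if_splits)
    also have "emeasure (torus d) (?E ?B) = (\<Prod>j\<in>J. emeasure circle_measure (?B j))"
      unfolding torus_def using J B by (intro P.emeasure_PiM_emb) auto
    also have "\<dots> = (\<Prod>j\<in>J. emeasure circle_measure (A j))"
      using J A c by (intro prod.cong refl emeasure_circle_measure_rotate) auto
    also have "\<dots> = emeasure (torus d) (?E A)"
      unfolding torus_def using J A by (intro P.emeasure_PiM_emb[symmetric]) auto
    finally show "emeasure (distr (Pi\<^sub>M (coords d) (\<lambda>_. circle_measure)) (Pi\<^sub>M (coords d) (\<lambda>_. circle_measure)) (rotate_torus d c)) (?E A)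
      = emeasure (Pi\<^sub>M (coords d) (\<lambda>_. circle_measure)) (?E A)"
      by (simp add: torus_def)
  next
    have "finite_measure (distr (torus d) (torus d) (rotate_torus d c))"
      by (intro finite_measure.finite_measure_distr m) unfold_locales
    then show "finite_measure (distr (Pi\<^sub>M (coords d) (\<lambda>_. circle_measure)) (Pi\<^sub>M (coords d) (\<lambda>_. circle_measure)) (rotate_torus d c))"
      by (simp add: torus_def)
  qed auto
qed

lemma integral_rotate_torus:
  fixes F :: "(nat \<Rightarrow> complex) \<Rightarrow> 'a::{banach, second_countable_topology}"
  assumes c: "\<And>j. j \<in> coords d \<Longrightarrow> norm (c j) = 1" and F: "F \<in> borel_measurable (torus d)"
  shows "(LINT z|torus d. F (rotate_torus d c z)) = (LINT z|torus d. F z)"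
  using integral_distr[OF measurable_rotate_torus[OF c] F] distr_rotate_torus[OF c] by simp

section \<open>Subharmonicity\<close>

lemma integrable_circle_measure_continuous:
  fixes f :: "complex \<Rightarrow> 'a::{banach, second_countable_topology}"
  assumes "continuous_on (sphere 0 1) f"
  shows "integrable circle_measure f"
proof -
  interpret prob_space circle_measure by (rule prob_space_circle_measure)
  have "f \<in> borel_measurable (restrict_space borel (sphere 0 1))"
    by (intro borel_measurable_continuous_on_restrict assms)
  then have m: "f \<in> borel_measurable circle_measure"
    by (simp add: measurable_cong_sets[OF sets_circle_measure refl])
  have "bounded (f ` sphere 0 1)"
    by (intro compact_imp_bounded compact_continuous_image assms) auto
  then obtain B where "\<And>w. w \<in> sphere 0 1 \<Longrightarrow> norm (f w) \<le> B"
    unfolding bounded_iff by blast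
  then show ?thesis
    using m by (intro integrable_const_bound[where B = B] AE_I2) (auto simp: space_circle_measure)
qed

lemma integral_circle_measure_rotate:
  fixes f :: "complex \<Rightarrow> 'a::{banach, second_countable_topology}"
  assumes f: "f \<in> borel_measurable circle_measure" and c: "norm c = 1"
  shows "(LINT w|circle_measure. f (c * w)) = (LINT w|circle_measure. f w)"
proof -
  note m = measurable_rotate_circle_measure[OF c]
  have "distr circle_measure circle_measure (\<lambda>w. c * w) = circle_measure"
    using emeasure_circle_measure_rotate[OF c] by (intro measure_eqI) (auto simp: emeasure_distr[OF m])
  then show ?thesis using integral_distr[OF m f] by simp
qed

text \<open>Rotation by the angle \<open>pi / n\<close> changes the sign of \<open>w ^ n\<close>, so
  the integral equals its own negative.\<close>

lemma integral_circle_measure_power: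
  assumes "0 < n"
  shows "(LINT w|circle_measure. w ^ n) = (0::complex)"
proof -
  define c where "c = cis (pi / n)"
  have "c ^ n = -1" using assms by (simp add: c_def Complex.DeMoivre)
  have "(LINT w|circle_measure. (c * w) ^ n) = (LINT w|circle_measure. w ^ n)"
    by (intro integral_circle_measure_rotate[where f = "\<lambda>w. w ^ n"] borel_measurable_integrable
        integrable_circle_measure_continuous continuous_intros) (simp add: c_def)
  then have "- (LINT w|circle_measure. w ^ n) = (LINT w|circle_measure. w ^ n)"
    by (simp add: power_mult_distrib \<open>c ^ n = -1\<close>)
  then show ?thesis by (simp add: neg_eq_iff_add_eq_0 flip: mult_2)
qed

text \<open>Integrating the power series at 0 term by term leaves only the constant term.\<close>

lemma integral_circle_measure_holomorphic:
  assumes "f holomorphic_on ball 0 R" "1 < R"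
  shows "(LINT w|circle_measure. f w) = f 0"
proof -
  interpret prob_space circle_measure by (rule prob_space_circle_measure)
  define a where "a n = (deriv ^^ n) f 0 / fact n" for n
  have sums: "(\<lambda>n. a n * w ^ n) sums f w" if "norm w < R" for w
    using holomorphic_power_series[OF assms(1), of w] that by (simp add: a_def)
  \<comment> \<open>Convergence at a point beyond the unit circle makes the coefficients absolutely
    summable, which justifies exchanging sum and integral.\<close>
  obtain x where x: "1 < x" "x < R" using dense[OF assms(2)] by blast
  have "summable (\<lambda>n. a n * complex_of_real x ^ n)"
    using sums[of "complex_of_real x"] x by (auto simp: sums_iff)
  then have "summable (\<lambda>n. norm (a n * 1 ^ n))"
    using x by (intro powser_insidea[where x = "complex_of_real x"]) auto
  then have sa: "summable (\<lambda>n. norm (a n))" by simp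
  have i: "integrable circle_measure (\<lambda>w. a n * w ^ n)" for n
    by (intro integrable_circle_measure_continuous continuous_intros)
  have n: "norm (a n * w ^ n) = norm (a n)" if "w \<in> space circle_measure" for w n
    using that by (simp add: space_circle_measure norm_mult norm_power)
  have ni: "(LINT w|circle_measure. norm (a n * w ^ n)) = norm (a n)" for n
    using n by (subst Bochner_Integration.integral_cong[OF refl n]) (auto simp: prob_space)
  have "(\<lambda>n. LINT w|circle_measure. a n * w ^ n) sums (LINT w|circle_measure. suminf (\<lambda>n. a n * w ^ n))"
    by (intro sums_integral i AE_I2) (simp_all only: n ni sa)
  moreover have "(LINT w|circle_measure. suminf (\<lambda>n. a n * w ^ n)) = (LINT w|circle_measure. f w)"
    using sums assms(2) by (intro Bochner_Integration.integral_cong)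
      (auto simp: space_circle_measure sums_iff)
  moreover have "(LINT w|circle_measure. a n * w ^ n) = (if n = 0 then a 0 else 0)" for n
    by (auto simp: integral_circle_measure_power prob_space)
  then have "(\<lambda>n. LINT w|circle_measure. a n * w ^ n) sums a 0"
    using sums_single[of 0 "\<lambda>_. a 0"] by simp
  ultimately have "(LINT w|circle_measure. f w) = a 0"
    using sums_unique2 by metis
  then show ?thesis by (simp add: a_def)
qed

text \<open>A zero-free \<open>f\<close> has a holomorphic logarithm \<open>g\<close> on the disc,
  and \<open>exp (p * g w)\<close> is a holomorphic branch of the power with modulus
  \<open>norm (f w) powr p\<close>. The mean value property of this branch gives the bound.\<close>

lemma norm_powr_le_integral_circle_measure_nonzero:
  assumes f: "f holomorphic_on ball 0 R" and R: "1 < R" and nz: "\<And>w. w \<in> ball 0 R \<Longrightarrow> f w \<noteq> 0"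
  shows "norm (f 0) powr p \<le> (LINT w|circle_measure. norm (f w) powr p)"
proof -
  obtain g where g: "g holomorphic_on ball 0 R" "\<And>w. w \<in> ball 0 R \<Longrightarrow> exp (g w) = f w"
    using holomorphic_logarithm_exists[OF convex_ball open_ball f nz, of 0] R by auto
  have e: "norm (exp (p * g w)) = norm (f w) powr p" if "w \<in> ball 0 R" for w
    using g(2)[OF that, symmetric] by (simp add: powr_def)
  have h: "(\<lambda>w. exp (p * g w)) holomorphic_on ball 0 R"
    by (intro holomorphic_intros g)
  have "norm (f 0) powr p = norm (exp (p * g 0))" using R e[of 0] by simp
  also have "\<dots> = norm (LINT w|circle_measure. exp (p * g w))"
    by (simp add: integral_circle_measure_holomorphic[OF h R])
  also have "\<dots> \<le> (LINT w|circle_measure. norm (exp (p * g w)))"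
    by (rule integral_norm_bound)
  also have "\<dots> = (LINT w|circle_measure. norm (f w) powr p)"
    using R by (intro Bochner_Integration.integral_cong e) (auto simp: space_circle_measure)
  finally show ?thesis .
qed

lemma norm_powr_le_integral_circle_measure_nonzero_disc:
  assumes f: "f holomorphic_on UNIV" and nz: "\<And>w. norm w < 1 \<Longrightarrow> f w \<noteq> 0" and p: "0 < p"
  shows "norm (f 0) powr p \<le> (LINT w|circle_measure. norm (f w) powr p)"
proof -
  interpret prob_space circle_measure by (rule prob_space_circle_measure)
  \<comment> \<open>The shift by 2 keeps \<open>\<rho> 0\<close> positive, so that
    \<open>1 / \<rho> n\<close> is always a radius above 1.\<close>
  define \<rho> :: "nat \<Rightarrow> real" where "\<rho> n = 1 - 1 / (n + 2)" for n
  have \<rho>: "0 < \<rho> n" "\<rho> n < 1" for n by (auto simp: \<rho>_def field_simps)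
  have \<rho>lim: "\<rho> \<longlonglongrightarrow> 1" unfolding \<rho>_def by real_asymp
  have cf: "continuous_on UNIV f" using f by (rule holomorphic_on_imp_continuous_on)
  have "bounded (f ` cball 0 1)"
    by (intro compact_imp_bounded compact_continuous_image continuous_on_subset[OF cf]) auto
  then obtain B where "\<forall>w\<in>cball 0 1. norm (f w) \<le> B"
    unfolding bounded_iff by blast
  then have B: "norm (f w) \<le> B" if "norm w \<le> 1" for w
    using that by simp
  have cs: "continuous_on (sphere 0 1) (\<lambda>w. norm (f (c * w)) powr p)" for c
    using p by (intro continuous_on_powr' continuous_intros continuous_on_compose2[OF cf]) auto
  have "norm (f 0) powr p \<le> (LINT w|circle_measure. norm (f (\<rho> n * w)) powr p)" for n
  proof -
    have "(\<lambda>w. f (\<rho> n * w)) holomorphic_on ball 0 (1 / \<rho> n)"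
      by (intro holomorphic_on_compose_gen[OF _ f, unfolded o_def] holomorphic_intros) auto
    moreover have "f (\<rho> n * w) \<noteq> 0" if "w \<in> ball 0 (1 / \<rho> n)" for w :: complex
      using that \<rho>[of n] by (intro nz) (auto simp: norm_mult field_simps)
    ultimately show ?thesis
      using norm_powr_le_integral_circle_measure_nonzero[of "\<lambda>w. f (\<rho> n * w)" "1 / \<rho> n" p] \<rho>[of n] by simp
  qed
  moreover have "(\<lambda>n. LINT w|circle_measure. norm (f (\<rho> n * w)) powr p)
      \<longlonglongrightarrow> (LINT w|circle_measure. norm (f (1 * w)) powr p)"
  proof (rule integral_dominated_convergence[where w = "\<lambda>_. B powr p"])
    show "AE w in circle_measure. (\<lambda>n. norm (f (\<rho> n * w)) powr p) \<longlonglongrightarrow> norm (f (1 * w)) powr p"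
    proof (rule AE_I2)
      fix w
      have "isCont f (1 * w)" using cf by (simp add: continuous_on_eq_continuous_at)
      moreover have "(\<lambda>n. \<rho> n * w) \<longlonglongrightarrow> 1 * w"
        using tendsto_of_real[OF \<rho>lim, where 'a = complex] by (intro tendsto_mult tendsto_const) simp
      ultimately show "(\<lambda>n. norm (f (\<rho> n * w)) powr p) \<longlonglongrightarrow> norm (f (1 * w)) powr p"
        using p by (intro tendsto_powr' tendsto_norm isCont_tendsto_compose[of _ f]) auto
    qed
    show "AE w in circle_measure. norm (norm (f (\<rho> n * w)) powr p) \<le> B powr p" for n
    proof (rule AE_I2)
      fix w assume "w \<in> space circle_measure"
      then have "norm (\<rho> n * w) \<le> 1"
        using \<rho>[of n] by (simp add: space_circle_measure norm_mult)
      then show "norm (norm (f (\<rho> n * w)) powr p) \<le> B powr p"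
        using B p by (auto intro!: powr_mono2)
    qed
  qed (use cs cs[of 1] in \<open>auto intro!: borel_measurable_integrable integrable_circle_measure_continuous\<close>)
  ultimately show ?thesis
    by (simp add: LIMSEQ_le_const)
qed


text \<open>By induction on the degree, one linear factor \<open>w - a\<close> is treated at a time.
  If \<open>a\<close> lies in the open disc, the factor is replaced by \<open>1 - cnj a * w\<close>:
  its zeros lie outside the closed disc, its modulus on the circle is the same, and at 0 its value
  is 1 instead of \<open>- a\<close>.\<close>

lemma poly_reflect_roots:
  fixes g :: "complex poly"
  assumes "g \<noteq> 0"
  obtains h :: "complex poly" where "\<And>w. norm w < 1 \<Longrightarrow> poly h w \<noteq> 0"
    "\<And>w. norm w = 1 \<Longrightarrow> norm (poly h w) = norm (poly g w)" "norm (poly g 0) \<le> norm (poly h 0)"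
  using assms
proof (induction "degree g" arbitrary: g thesis)
  case 0
  then obtain c where "g = [:c:]" using degree_eq_zeroE by metis
  with 0 show ?case by (intro 0(2)[of g]) auto
next
  case (Suc n)
  then obtain a where "poly g a = 0"
    using Fundamental_Theorem_Algebra.fundamental_theorem_of_algebra[of g] by (auto simp: constant_degree)
  then obtain g' where g: "g = [:-a, 1:] * g'" by (auto simp: poly_eq_0_iff_dvd elim: dvdE)
  with Suc(4) have "g' \<noteq> 0" by auto
  moreover have "n = degree g'" using Suc(2) \<open>g' \<noteq> 0\<close> unfolding g by (subst (asm) degree_mult_eq) auto
  ultimately obtain h where h: "\<And>w. norm w < 1 \<Longrightarrow> poly h w \<noteq> 0"
    "\<And>w. norm w = 1 \<Longrightarrow> norm (poly h w) = norm (poly g' w)" "norm (poly g' 0) \<le> norm (poly h 0)"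
    using Suc(1) by blast
  have lin: "poly ([:c, d:] * f) w = (c + w * d) * poly f w" for c d w :: complex and f
    unfolding poly_mult by simp
  show ?case
  proof (cases "1 \<le> norm a")
    case True
    show ?thesis
      by (rule Suc(3)[of "[:-a, 1:] * h"]) (use h True in \<open>auto simp: g lin norm_mult mult_left_mono simp del: mult_pCons_left\<close>)
  next
    case False
    have 1: "1 - cnj a * w \<noteq> 0" if "norm w < 1" for w
    proof
      assume "1 - cnj a * w = 0"
      then have "norm (cnj a * w) = 1" by simp
      moreover have "norm (cnj a * w) < 1"
        using False that mult_strict_mono'[of "norm a" 1 "norm w" 1] by (simp add: norm_mult)
      ultimately show False by simp
    qed
    have 2: "norm (1 - cnj a * w) = norm (w - a)" if "norm w = 1" for w
    proof -
      have "w * cnj w = 1" using that by (simp add: complex_norm_square[symmetric])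
      \<comment> \<open>On the circle the reflected factor is the conjugate of the original one, up
        to the unimodular factor \<open>w\<close>.\<close>
      then have "1 - cnj a * w = w * cnj (w - a)" by (simp add: algebra_simps)
      then show ?thesis by (simp only: norm_mult that complex_mod_cnj)
    qed
    have 3: "norm a * norm (poly g' 0) \<le> norm (poly h 0)"
      using mult_mono[of "norm a" 1, OF _ h(3)] False by simp
    show ?thesis
      by (rule Suc(3)[of "[:1, -cnj a:] * h"])
        (use h False 1 2 3 in \<open>auto simp: g lin norm_mult mult.commute[of _ "cnj a"] simp del: mult_pCons_left\<close>)
  qed
qed

text \<open>The mean value property applies to a branch of \<open>h\<^sup>p\<close> once the zeros in the disc have been
  reflected in the circle, which preserves \<open>norm g\<close> on the circle and can only increase \<open>norm (g 0)\<close>.\<close>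

lemma norm_poly_powr_le_integral_circle_measure:
  fixes g :: "complex poly"
  assumes "0 < p"
  shows "norm (poly g 0) powr p \<le> (LINT w|circle_measure. norm (poly g w) powr p)"
proof (cases "g = 0")
  case False
  then obtain h where h: "\<And>w. norm w < 1 \<Longrightarrow> poly h w \<noteq> 0"
    "\<And>w. norm w = 1 \<Longrightarrow> norm (poly h w) = norm (poly g w)" "norm (poly g 0) \<le> norm (poly h 0)"
    by (rule poly_reflect_roots) blast
  have "norm (poly g 0) powr p \<le> norm (poly h 0) powr p"
    using assms h(3) by (intro powr_mono2) auto
  also have "\<dots> \<le> (LINT w|circle_measure. norm (poly h w) powr p)"
    using assms h(1) by (intro norm_powr_le_integral_circle_measure_nonzero_disc) (auto intro!: holomorphic_intros)
  also have "\<dots> = (LINT w|circle_measure. norm (poly g w) powr p)"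
    by (intro Bochner_Integration.integral_cong) (auto simp: space_circle_measure h(2))
  finally show ?thesis .
qed (use assms in simp)

section \<open>Perturbations of constants\<close>

lemma borel_measurable_cnj [measurable]: "cnj \<in> borel_measurable borel"
  by (intro borel_measurable_continuous_onI continuous_intros)

text \<open>The constants are made explicit because the bound is applied under an integral, to an
  \<open>s\<close> that depends on the integration variable. The condition
  \<open>\<eta> \<le> 1 / 2\<close> keeps \<open>1 + s\<close> positive.\<close>

lemma powr_taylor2_bound:
  fixes r :: real
  obtains C \<eta> where "0 < C" "0 < \<eta>" "\<eta> \<le> 1 / 2"
    "\<And>s. \<bar>s\<bar> < \<eta> \<Longrightarrow> \<bar>(1 + s) powr r - (1 + r * s + r * (r - 1) / 2 * s\<^sup>2)\<bar> \<le> C * \<bar>s\<bar> ^ 3"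
proof -
  have "(\<lambda>s::real. (1 + s) powr r - (1 + r * s + r * (r - 1) / 2 * s\<^sup>2)) \<in> O[at 0](\<lambda>s. s ^ 3)"
    by real_asymp
  then obtain C where C: "0 < C"
    "eventually (\<lambda>s. norm ((1 + s) powr r - (1 + r * s + r * (r - 1) / 2 * s\<^sup>2)) \<le> C * norm (s ^ 3)) (at 0)"
    by (elim landau_o.bigE)
  then obtain \<eta> where \<eta>: "0 < \<eta>" "\<And>s. s \<noteq> 0 \<Longrightarrow> dist s 0 < \<eta> \<Longrightarrow>
      norm ((1 + s) powr r - (1 + r * s + r * (r - 1) / 2 * s\<^sup>2)) \<le> C * norm (s ^ 3)"
    unfolding eventually_at by blast
  show ?thesis
  proof (rule that[of C "min \<eta> (1 / 2)"])
    fix s :: real assume "\<bar>s\<bar> < min \<eta> (1 / 2)"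
    then show "\<bar>(1 + s) powr r - (1 + r * s + r * (r - 1) / 2 * s\<^sup>2)\<bar> \<le> C * \<bar>s\<bar> ^ 3"
      using \<eta>(2)[of s] by (cases "s = 0") (auto simp: power_abs)
  qed (use C \<eta> in auto)
qed

text \<open>This is concavity, obtained from the weighted inequality of arithmetic and geometric
  means for \<open>Y / X\<close> and 1 with weights \<open>q\<close> and
  \<open>1 - q\<close>.\<close>

lemma powr_le_tangent:
  fixes X Y q :: real
  assumes "0 < X" "0 \<le> Y" "0 < q" "q < 1"
  shows "Y powr q \<le> X powr q + q * X powr (q - 1) * (Y - X)"
proof (cases "Y = 0")
  case True
  have "X powr (q - 1) * X = X powr q"
    using assms by (simp add: powr_diff)
  moreover have "q * X powr q \<le> X powr q"
    using assms by (intro mult_left_le_one_le) auto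
  ultimately show ?thesis using True by (simp add: mult.assoc)
next
  case False
  then have "Y / X > 0" using assms by simp
  then have "(Y / X) powr q * 1 powr (1 - q) \<le> q * (Y / X) + (1 - q) * 1"
    using assms by (intro Youngs_inequality_0) auto
  then have "X powr q * (Y / X) powr q \<le> X powr q * (1 + q * (Y - X) / X)"
    using assms by (intro mult_left_mono) (auto simp: field_simps)
  moreover have "X powr q * (Y / X) powr q = Y powr q"
    using assms by (simp add: powr_divide)
  moreover have "X powr q * (1 + q * (Y - X) / X) = X powr q + q * X powr (q - 1) * (Y - X)"
    using assms by (simp add: powr_diff field_simps)
  ultimately show ?thesis by simp
qed

text \<open>The perturbed function is the real function
  \<open>1 + 2 * \<epsilon> * Re (w z)\<close>. In the Taylor expansion of its power the linear term
  integrates to 0 by \<open>w1\<close>. The quadratic coefficient is negative since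
  \<open>p < 1\<close>, and by \<open>w2\<close> the mean square of \<open>Re (w z)\<close> is
  \<open>1 / 2\<close>.\<close>

lemma (in prob_space) symmetric_perturbation_decreases:
  fixes w :: "'a \<Rightarrow> complex"
  assumes [measurable]: "w \<in> borel_measurable M" and w: "\<And>z. z \<in> space M \<Longrightarrow> norm (w z) = 1"
    and w1: "(LINT z|M. w z) = 0" and w2: "(LINT z|M. (w z)\<^sup>2) = 0" and p: "0 < p" "p < 1"
  obtains \<epsilon> :: real where
    "(LINT z|M. norm (1 + \<epsilon> * (w z + cnj (w z))) powr p) < 1"
proof -
  obtain C \<eta> where C: "0 < C" "0 < \<eta>" "\<eta> \<le> 1 / 2" and
    T: "\<And>s. \<bar>s\<bar> < \<eta> \<Longrightarrow> \<bar>(1 + s) powr p - (1 + p * s + p * (p - 1) / 2 * s\<^sup>2)\<bar> \<le> C * \<bar>s\<bar> ^ 3"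
    by (rule powr_taylor2_bound[of p]) blast
  \<comment> \<open>The quadratic Taylor coefficient is \<open>- c\<close>; one half of it is spent
    on absorbing the cubic remainder.\<close>
  define c where "c = p * (1 - p) / 2"
  have c: "0 < c" using p by (simp add: c_def)
  \<comment> \<open>The first bound keeps \<open>\<bar>s\<bar>\<close> below \<open>\<eta>\<close>,
    the second makes \<open>C * \<bar>s\<bar>\<close> at most \<open>c / 2\<close>.\<close>
  define \<epsilon> where "\<epsilon> = min (\<eta> / 4) (c / (8 * C))"
  have \<epsilon>: "0 < \<epsilon>" "2 * \<epsilon> < \<eta>" "\<epsilon> * (4 * C) \<le> c / 2"
    using C c by (auto simp: \<epsilon>_def min_def field_simps)
  have ptw: "norm (1 + \<epsilon> * (w z + cnj (w z))) powr p
      \<le> 1 + 2 * p * \<epsilon> * Re (w z) - c * \<epsilon>\<^sup>2 * (1 + Re ((w z)\<^sup>2))" if "z \<in> space M" for z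
  proof -
    define x where "x = Re (w z)"
    have x: "\<bar>x\<bar> \<le> 1" using abs_Re_le_cmod[of "w z"] w[OF that] by (simp add: x_def)
    have "x\<^sup>2 + (Im (w z))\<^sup>2 = 1"
      using w[OF that] by (simp add: x_def cmod_def)
    then have re2: "Re ((w z)\<^sup>2) = 2 * x\<^sup>2 - 1"
      by (simp add: x_def power2_eq_square)
    define s where "s = 2 * \<epsilon> * x"
    have s: "\<bar>s\<bar> \<le> 2 * \<epsilon>" using x \<epsilon> by (simp add: s_def abs_mult mult_left_le)
    then have s': "\<bar>s\<bar> < \<eta>" using \<epsilon> by simp
    have "1 + \<epsilon> * (w z + cnj (w z)) = complex_of_real (1 + s)"
      by (simp add: complex_eq_iff s_def x_def)
    then have n: "norm (1 + \<epsilon> * (w z + cnj (w z))) = 1 + s"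
      using s' C by (simp only: norm_of_real)
    have "C * \<bar>s\<bar> ^ 3 = C * \<bar>s\<bar> * s\<^sup>2" by (simp add: power3_eq_cube power2_eq_square)
    also have "\<dots> \<le> c / 2 * s\<^sup>2"
    proof (rule mult_right_mono)
      have "C * \<bar>s\<bar> \<le> C * (2 * \<epsilon>)" using s C by simp
      also have "\<dots> \<le> c / 2" using \<epsilon> c by (simp add: mult_ac)
      finally show "C * \<bar>s\<bar> \<le> c / 2" .
    qed auto
    finally have "C * \<bar>s\<bar> ^ 3 \<le> c / 2 * s\<^sup>2" .
    moreover have "p * (p - 1) / 2 * s\<^sup>2 = - (c / 2 * s\<^sup>2) - c / 2 * s\<^sup>2"
      by (simp add: c_def field_simps)
    ultimately have "(1 + s) powr p \<le> 1 + p * s - c / 2 * s\<^sup>2"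
      using abs_le_D1[OF T[OF s']] by linarith
    then show ?thesis unfolding n re2 by (simp add: s_def x_def power_mult_distrib algebra_simps)
  qed
  have iw: "integrable M w" "integrable M (\<lambda>z. (w z)\<^sup>2)"
    by (auto intro!: integrable_const_bound[where B = 1] AE_I2 simp: w norm_power)
  have "(LINT z|M. norm (1 + \<epsilon> * (w z + cnj (w z))) powr p)
     \<le> (LINT z|M. 1 + 2 * p * \<epsilon> * Re (w z) - c * \<epsilon>\<^sup>2 * (1 + Re ((w z)\<^sup>2)))"
  proof (rule integral_mono)
    show "integrable M (\<lambda>z. norm (1 + \<epsilon> * (w z + cnj (w z))) powr p)"
    proof (rule integrable_const_bound[where B = "(1 + \<epsilon> * 2) powr p"])
      have "norm (1 + \<epsilon> * (w z + cnj (w z))) \<le> 1 + \<epsilon> * 2" if "z \<in> space M" for z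
        using \<epsilon>(1) w[OF that] norm_triangle_ineq[of "w z" "cnj (w z)"]
        by (intro norm_triangle_le) (auto simp: norm_mult)
      then show "AE z in M. norm (norm (1 + \<epsilon> * (w z + cnj (w z))) powr p) \<le> (1 + \<epsilon> * 2) powr p"
        using p by (intro AE_I2) (auto intro!: powr_mono2)
    qed measurable
  qed (use ptw iw in auto)
  also have "\<dots> = 1 - c * \<epsilon>\<^sup>2"
    using iw w1 w2 by (simp add: prob_space integral_Re)
  also have "\<dots> < 1" using c \<epsilon> by simp
  finally show ?thesis by (rule that)
qed

text \<open>With \<open>r = q - 1\<close>, the expanded quantity is, up to a factor, the derivative of \<open>norm x powr (2 * q)\<close>
  at \<open>x = 1 + \<epsilon> (a + b)\<close> in the direction \<open>a b\<close>. For the monomials substituted later all terms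
  of the expansion integrate to \<open>0\<close>, except the one containing \<open>2 + 2 Re (a * cnj b)\<close>.\<close>

lemma norm_one_plus_times_cnj_expansion:
  fixes r :: real
  obtains K \<epsilon>\<^sub>0 where "0 < K" "0 < \<epsilon>\<^sub>0" "\<epsilon>\<^sub>0 \<le> 1 / 8"
    "\<And>(\<epsilon>::real) (a::complex) (b::complex). 0 \<le> \<epsilon> \<Longrightarrow> \<epsilon> < \<epsilon>\<^sub>0 \<Longrightarrow> norm a = 1 \<Longrightarrow> norm b = 1 \<Longrightarrow>
      norm (complex_of_real (((norm (1 + \<epsilon> * (a + b)))\<^sup>2) powr r) * (1 + \<epsilon> * cnj (a + b)) * (a * b)
        - (a * b + \<epsilon> * (r * (a\<^sup>2 * b + a * b\<^sup>2 + a + b) + a + b)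
           + \<epsilon>\<^sup>2 * (r * (r + 1) * (2 * a * b + a\<^sup>2 + b\<^sup>2)
               + r * (r - 1) / 2 * (a ^ 3 * b + 2 * a\<^sup>2 * b\<^sup>2 + a * b ^ 3)
               + r * (r + 1) / 2 * (2 + 2 * Re (a * cnj b))))) \<le> K * \<epsilon> ^ 3"
proof -
  obtain C \<eta> where C: "0 < C" "0 < \<eta>" "\<eta> \<le> 1 / 2" and
    T: "\<And>s. \<bar>s\<bar> < \<eta> \<Longrightarrow> \<bar>(1 + s) powr r - (1 + r * s + r * (r - 1) / 2 * s\<^sup>2)\<bar> \<le> C * \<bar>s\<bar> ^ 3"
    by (rule powr_taylor2_bound[of r]) blast
  define k where "k = r * (r - 1) / 2"
  \<comment> \<open>The summands bound, in this order, the Taylor remainder \<open>R\<close> with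
    its factor of norm at most 2, then \<open>M\<^sub>0\<close>, then \<open>M\<^sub>1\<close> and
    \<open>M\<^sub>2\<close>.\<close>
  define K where "K = 1024 * C + (64 * \<bar>k\<bar> + 8 * \<bar>r\<bar>) + (80 * \<bar>k\<bar> + 32 * \<bar>k\<bar>) + 1"
  show ?thesis
  proof (rule that[of K "\<eta> / 8"])
    fix \<epsilon> :: real and a b :: complex
    assume \<epsilon>: "0 \<le> \<epsilon>" "\<epsilon> < \<eta> / 8" and ab: "norm a = 1" "norm b = 1"
    define A where "A = a + b"
    define S where "S = A + cnj A"
    define N where "N = A * cnj A"
    \<comment> \<open>With this \<open>s\<close> the squared norm is exactly \<open>1 + s\<close>,
      so the Taylor bound applies.\<close>
    define s where "s = 2 * \<epsilon> * Re A + \<epsilon>\<^sup>2 * (norm A)\<^sup>2"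
    have \<epsilon>1: "\<epsilon> \<le> 1" using \<epsilon> C by simp
    have nA: "norm A \<le> 2" using norm_triangle_ineq[of a b] ab by (simp add: A_def)
    have nS: "norm S \<le> 4" using norm_triangle_ineq[of A "cnj A"] nA by (simp add: S_def)
    have nN: "norm N \<le> 4" using mult_mono[OF nA nA] by (simp add: N_def norm_mult)
    have ncA: "norm (cnj A) \<le> 2" using nA by simp
    have sq: "(norm (1 + \<epsilon> * A))\<^sup>2 = 1 + s"
      unfolding s_def cmod_power2 by (simp add: power2_eq_square algebra_simps)
    have sc: "complex_of_real s = \<epsilon> * S + \<epsilon>\<^sup>2 * N"
      by (simp add: s_def S_def N_def complex_norm_square[symmetric] complex_add_cnj)
    have "\<bar>s\<bar> = norm (\<epsilon> * S + \<epsilon>\<^sup>2 * N)"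
      by (metis sc norm_of_real)
    also have "\<dots> \<le> \<epsilon> * 4 + \<epsilon>\<^sup>2 * 4"
      using nS nN \<epsilon> by (intro norm_triangle_mono) (auto simp: norm_mult norm_power intro!: mult_mono)
    also have "\<dots> \<le> 8 * \<epsilon>"
      using \<epsilon> \<epsilon>1 mult_left_le[of \<epsilon> \<epsilon>] by (simp add: power2_eq_square)
    finally have s: "\<bar>s\<bar> \<le> 8 * \<epsilon>" .
    then have s': "\<bar>s\<bar> < \<eta>" using \<epsilon> by simp
    define R where "R = (1 + s) powr r - (1 + r * s + k * s\<^sup>2)"
    have "\<bar>R\<bar> \<le> C * \<bar>s\<bar> ^ 3" using T[OF s'] by (simp add: R_def k_def)
    also have "\<dots> \<le> C * (8 * \<epsilon>) ^ 3"
      using s C by (intro mult_left_mono power_mono) auto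
    finally have R: "\<bar>R\<bar> \<le> 512 * C * \<epsilon> ^ 3" by (simp add: power_mult_distrib)
    \<comment> \<open>These are the coefficients of the third, fourth and fifth powers of \<epsilon>
      in the product of the Taylor polynomial in \<open>s\<close> with
      \<open>1 + \<epsilon> * cnj A\<close>.\<close>
    define M\<^sub>0 where "M\<^sub>0 = 2 * k * S * N + r * N * cnj A + k * S\<^sup>2 * cnj A"
    define M\<^sub>1 where "M\<^sub>1 = k * N\<^sup>2 + 2 * k * S * N * cnj A"
    define M\<^sub>2 where "M\<^sub>2 = k * N\<^sup>2 * cnj A"
    have m: "norm (x * y) \<le> c * d" if "norm x \<le> c" "norm y \<le> d" for x y :: complex and c d
      using that order_trans[OF norm_ge_zero that(1)] by (simp add: norm_mult mult_mono')
    have pw: "norm (x\<^sup>2) \<le> 16" if "norm x \<le> 4" for x :: complex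
      using m[OF that that] by (simp add: power2_eq_square)
    have M0: "norm M\<^sub>0 \<le> (2 * \<bar>k\<bar>) * 4 * 4 + \<bar>r\<bar> * 4 * 2 + \<bar>k\<bar> * 16 * 2"
      unfolding M\<^sub>0_def
      by (intro norm_triangle_mono m nS nN ncA pw) (simp_all add: norm_mult)
    have M1: "norm M\<^sub>1 \<le> \<bar>k\<bar> * 16 + (2 * \<bar>k\<bar>) * 4 * 4 * 2"
      unfolding M\<^sub>1_def
      by (intro norm_triangle_mono m nS nN ncA pw) (simp_all add: norm_mult)
    have M2: "norm M\<^sub>2 \<le> \<bar>k\<bar> * 16 * 2"
      unfolding M\<^sub>2_def
      by (intro norm_triangle_mono m nS nN ncA pw) (simp_all add: norm_mult)
    have aa: "a * cnj a = 1" "b * cnj b = 1"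
      using ab by (simp_all add: complex_norm_square[symmetric])
    have "complex_of_real (Re (a * cnj b) * 2) = a * cnj b + cnj (a * cnj b)"
      by (subst complex_add_cnj) simp
    then have re: "2 * complex_of_real (Re (a * cnj b)) = a * cnj b + b * cnj a"
      by (simp add: mult.commute)
    let ?L = "a * b + \<epsilon> * (r * (a\<^sup>2 * b + a * b\<^sup>2 + a + b) + a + b)
           + \<epsilon>\<^sup>2 * (r * (r + 1) * (2 * a * b + a\<^sup>2 + b\<^sup>2)
               + r * (r - 1) / 2 * (a ^ 3 * b + 2 * a\<^sup>2 * b\<^sup>2 + a * b ^ 3)
               + r * (r + 1) / 2 * (2 + 2 * Re (a * cnj b)))"
    \<comment> \<open>Since \<open>a\<close> and \<open>b\<close> are unimodular, the factor
      \<open>a * b\<close> clears the conjugates and leaves monomials in \<open>a\<close> and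
      \<open>b\<close>.\<close>
    have AB: "cnj A * (a * b) = A"
    proof -
      have "cnj A * (a * b) = (a * cnj a) * b + (b * cnj b) * a"
        by (simp add: A_def algebra_simps)
      then show ?thesis by (simp add: aa A_def)
    qed
    \<comment> \<open>This is the one contribution that is not a combination of monomials of
      positive degree, hence the one that survives integration later.\<close>
    have cAA: "cnj A * A = 2 + 2 * complex_of_real (Re (a * cnj b))"
    proof -
      have "cnj A * A = a * cnj a + b * cnj b + (a * cnj b + b * cnj a)"
        by (simp add: A_def algebra_simps)
      then show ?thesis by (simp only: aa re one_add_one)
    qed
    have "(r * N + k * S\<^sup>2 + r * S * cnj A) * (a * b)
      = r * A * (cnj A * (a * b)) + k * (A\<^sup>2 * (a * b) + 2 * A * (cnj A * (a * b)) + cnj A * (cnj A * (a * b)))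
        + r * (A * (cnj A * (a * b)) + cnj A * (cnj A * (a * b)))"
      by (simp add: N_def S_def power2_eq_square algebra_simps)
    also have "\<dots> = (2 * r + 2 * k) * A\<^sup>2 + k * (A\<^sup>2 * (a * b)) + (k + r) * (cnj A * A)"
      unfolding AB by (simp add: power2_eq_square algebra_simps)
    also have "complex_of_real (2 * r + 2 * k) = r * (r + 1)"
      by (simp add: k_def field_simps)
    also have "complex_of_real (k + r) = r * (r + 1) / 2"
      by (simp add: k_def field_simps)
    also have "A\<^sup>2 * (a * b) = a ^ 3 * b + 2 * a\<^sup>2 * b\<^sup>2 + a * b ^ 3"
      by (simp add: A_def power2_eq_square power3_eq_cube algebra_simps)
    also have "A\<^sup>2 = 2 * a * b + a\<^sup>2 + b\<^sup>2"
      by (simp add: A_def power2_eq_square algebra_simps)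
    finally have e2: "(r * N + k * S\<^sup>2 + r * S * cnj A) * (a * b)
      = r * (r + 1) * (2 * a * b + a\<^sup>2 + b\<^sup>2)
               + r * (r - 1) / 2 * (a ^ 3 * b + 2 * a\<^sup>2 * b\<^sup>2 + a * b ^ 3)
               + r * (r + 1) / 2 * (2 + 2 * complex_of_real (Re (a * cnj b)))"
      unfolding cAA k_def by simp
    have "(r * S + cnj A) * (a * b) = r * (A * (a * b) + cnj A * (a * b)) + cnj A * (a * b)"
      by (simp add: S_def algebra_simps)
    then have e1: "(r * S + cnj A) * (a * b) = r * (a\<^sup>2 * b + a * b\<^sup>2 + a + b) + a + b"
      unfolding AB by (simp add: A_def power2_eq_square algebra_simps)
    have T': "complex_of_real (1 + r * s + k * s\<^sup>2) * (1 + \<epsilon> * cnj A)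
      = 1 + \<epsilon> * (r * S + cnj A) + \<epsilon>\<^sup>2 * (r * N + k * S\<^sup>2 + r * S * cnj A)
        + \<epsilon> ^ 3 * (M\<^sub>0 + \<epsilon> * M\<^sub>1 + \<epsilon>\<^sup>2 * M\<^sub>2)"
      unfolding of_real_add of_real_mult of_real_power sc M\<^sub>0_def M\<^sub>1_def M\<^sub>2_def
      by (simp add: algebra_simps power2_eq_square power3_eq_cube)
    let ?D = "complex_of_real (((norm (1 + \<epsilon> * (a + b)))\<^sup>2) powr r) * (1 + \<epsilon> * cnj (a + b)) * (a * b) - ?L"
    let ?E = "\<epsilon> ^ 3 * (M\<^sub>0 + \<epsilon> * M\<^sub>1 + \<epsilon>\<^sup>2 * M\<^sub>2) * (a * b) + R * (1 + \<epsilon> * cnj A) * (a * b)"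
    have "?D
       = (complex_of_real (1 + r * s + k * s\<^sup>2) * (1 + \<epsilon> * cnj A)) * (a * b)
         + R * (1 + \<epsilon> * cnj A) * (a * b) - ?L"
      unfolding A_def[symmetric] sq R_def by (simp add: algebra_simps)
    also have "\<dots> = a * b + \<epsilon> * ((r * S + cnj A) * (a * b)) + \<epsilon>\<^sup>2 * ((r * N + k * S\<^sup>2 + r * S * cnj A) * (a * b))
        + \<epsilon> ^ 3 * (M\<^sub>0 + \<epsilon> * M\<^sub>1 + \<epsilon>\<^sup>2 * M\<^sub>2) * (a * b)
         + R * (1 + \<epsilon> * cnj A) * (a * b) - ?L"
      unfolding T' by (simp add: distrib_right mult.assoc)
    also have "\<dots> = ?E"
      unfolding e1 e2 by simp
    finally have "?D = ?E" .
    moreover have "norm ?E \<le> \<epsilon> ^ 3 * ((2 * \<bar>k\<bar>) * 4 * 4 + \<bar>r\<bar> * 4 * 2 + \<bar>k\<bar> * 16 * 2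
        + 1 * (\<bar>k\<bar> * 16 + (2 * \<bar>k\<bar>) * 4 * 4 * 2) + 1 * (\<bar>k\<bar> * 16 * 2)) * 1
        + (512 * C * \<epsilon> ^ 3) * (1 + 1 / 2 * 2) * 1"
      using \<epsilon> \<epsilon>1 ab R C
      by (intro norm_triangle_mono m M0 M1 M2 ncA)
        (auto simp: norm_mult norm_power power_le_one)
    moreover have "\<dots> \<le> K * \<epsilon> ^ 3"
      using \<epsilon> by (simp add: K_def algebra_simps)
    ultimately show "norm ?D \<le> K * \<epsilon> ^ 3"
      by (simp only:)
  qed (use C in \<open>auto simp: K_def intro!: add_nonneg_pos\<close>)
qed

text \<open>The tangent line inequality for \<open>x powr q\<close> at \<open>X z\<close> bounds the
  perturbed integral by the original one plus \<open>q * (2 * \<delta> * Re (LINT z|M. H z) +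
  \<delta>\<^sup>2 * B)\<close>. So it suffices that the mean of \<open>H\<close> has negative real
  part. In its expansion only a term of second order in \<epsilon> survives, and this is negative
  because \<open>0 < q < 1\<close>.\<close>

lemma (in prob_space) product_perturbation_decreases:
  fixes u v :: "'a \<Rightarrow> complex"
  assumes [measurable]: "u \<in> borel_measurable M" "v \<in> borel_measurable M"
    and u: "\<And>z. z \<in> space M \<Longrightarrow> norm (u z) = 1" and v: "\<And>z. z \<in> space M \<Longrightarrow> norm (v z) = 1"
    and orth: "\<And>m n. 0 < m + n \<Longrightarrow> (LINT z|M. u z ^ m * v z ^ n) = 0"
    and re: "0 \<le> Re (LINT z|M. u z * cnj (v z))" and q: "0 < q" "q < 1"
  obtains \<epsilon> \<delta> :: real where
    "(LINT z|M. norm (1 + \<epsilon> * (u z + v z) + \<delta> * (u z * v z)) powr (2 * q))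
      < (LINT z|M. norm (1 + \<epsilon> * (u z + v z)) powr (2 * q))"
proof -
  define r where "r = q - 1"
  obtain K \<epsilon>\<^sub>0 where K: "0 < K" "0 < \<epsilon>\<^sub>0" "\<epsilon>\<^sub>0 \<le> 1 / 8" and
    exp: "\<And>(\<epsilon>::real) (a::complex) (b::complex). 0 \<le> \<epsilon> \<Longrightarrow> \<epsilon> < \<epsilon>\<^sub>0 \<Longrightarrow> norm a = 1 \<Longrightarrow> norm b = 1 \<Longrightarrow>
      norm (complex_of_real (((norm (1 + \<epsilon> * (a + b)))\<^sup>2) powr r) * (1 + \<epsilon> * cnj (a + b)) * (a * b)
        - (a * b + \<epsilon> * (r * (a\<^sup>2 * b + a * b\<^sup>2 + a + b) + a + b)
           + \<epsilon>\<^sup>2 * (r * (r + 1) * (2 * a * b + a\<^sup>2 + b\<^sup>2)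
               + r * (r - 1) / 2 * (a ^ 3 * b + 2 * a\<^sup>2 * b\<^sup>2 + a * b ^ 3)
               + r * (r + 1) / 2 * (2 + 2 * Re (a * cnj b))))) \<le> K * \<epsilon> ^ 3"
    by (rule norm_one_plus_times_cnj_expansion[of r]) blast
  \<comment> \<open>Up to sign, this is the coefficient of the surviving term.\<close>
  define c where "c = q * (1 - q) / 2"
  have c: "0 < c" using q by (simp add: c_def)
  have rc: "r * (r + 1) / 2 = - c" by (simp add: r_def c_def field_simps)
  \<comment> \<open>The choice of \<open>c / K\<close> makes the cubic error at most
    \<open>c * \<epsilon>\<^sup>2\<close>, half of what the surviving term is guaranteed to
    contribute.\<close>
  define \<epsilon> where "\<epsilon> = min (\<epsilon>\<^sub>0 / 2) (c / K)"
  have \<epsilon>: "0 < \<epsilon>" "\<epsilon> < \<epsilon>\<^sub>0" "K * \<epsilon> \<le> c"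
    using K c by (auto simp: \<epsilon>_def min_def field_simps)
  have \<epsilon>16: "\<epsilon> \<le> 1 / 16"
    using K min.cobounded1[of "\<epsilon>\<^sub>0 / 2" "c / K"] unfolding \<epsilon>_def by linarith
  define e where "e m n z = u z ^ m * v z ^ n" for m n :: nat and z
  define \<rho> where "\<rho> z = Re (u z * cnj (v z))" for z
  define X where "X z = (norm (1 + \<epsilon> * (u z + v z)))\<^sup>2" for z
  define H where "H z = complex_of_real (X z powr r) * (1 + \<epsilon> * cnj (u z + v z)) * (u z * v z)" for z
  \<comment> \<open>The expansion of \<open>H\<close> is sorted into the monomials
    \<open>e m n\<close>, which integrate to 0 by \<open>orth\<close>, and the term with
    \<open>\<rho>\<close>, whose mean is nonnegative by \<open>re\<close>.\<close>
  define L where "L z = e 1 1 z + \<epsilon> * (r * (e 2 1 z + e 1 2 z + e 1 0 z + e 0 1 z) + e 1 0 z + e 0 1 z)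
    + \<epsilon>\<^sup>2 * (r * (r + 1) * (2 * e 1 1 z + e 2 0 z + e 0 2 z)
       + r * (r - 1) / 2 * (e 3 1 z + 2 * e 2 2 z + e 1 3 z)
       + complex_of_real (- c * (2 + 2 * \<rho> z)))" for z
  have [measurable]: "X \<in> borel_measurable M" "H \<in> borel_measurable M" "\<rho> \<in> borel_measurable M"
    "\<And>m n. e m n \<in> borel_measurable M"
    unfolding X_def[abs_def] H_def[abs_def] e_def[abs_def] \<rho>_def[abs_def] by measurable
  have ie: "integrable M (e m n)" for m n
    by (rule integrable_const_bound[where B = 1]) (auto intro!: AE_I2 simp: e_def norm_mult norm_power u v)
  have ee: "(LINT z|M. e m n z) = 0" if "0 < m + n" for m n
    using orth[OF that] by (simp add: e_def)
  have iuv: "integrable M (\<lambda>z. u z * cnj (v z))"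
    by (rule integrable_const_bound[where B = 1]) (auto intro!: AE_I2 simp: norm_mult u v)
  then have i\<rho>: "integrable M \<rho>" unfolding \<rho>_def by (rule integrable_Re)
  have e\<rho>: "0 \<le> (LINT z|M. \<rho> z)" using re integral_Re[OF iuv] by (simp only: \<rho>_def)
  have iL: "integrable M L"
    unfolding L_def[abs_def] using ie i\<rho>
    by (intro Bochner_Integration.integrable_add integrable_mult_right) auto
  have "(LINT z|M. L z) = \<epsilon>\<^sup>2 * complex_of_real (- c * (2 + 2 * (LINT z|M. \<rho> z)))"
    unfolding L_def using ie i\<rho> by (simp add: ee prob_space)
  also have "\<dots> = complex_of_real (\<epsilon>\<^sup>2 * (- c * (2 + 2 * (LINT z|M. \<rho> z))))"
    by simp
  finally have EL: "Re (LINT z|M. L z) = - (c * \<epsilon>\<^sup>2) * (2 + 2 * (LINT z|M. \<rho> z))"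
    by simp
  have HL: "norm (H z - L z) \<le> c * \<epsilon>\<^sup>2" if z: "z \<in> space M" for z
  proof -
    have "norm (H z - L z) \<le> K * \<epsilon> ^ 3"
      using exp[OF less_imp_le[OF \<epsilon>(1)] \<epsilon>(2) u[OF z] v[OF z], folded \<rho>_def, unfolded rc]
      by (simp add: H_def L_def X_def e_def mult.assoc)
    also have "\<dots> = (K * \<epsilon>) * \<epsilon>\<^sup>2" by (simp add: power3_eq_cube power2_eq_square)
    also have "\<dots> \<le> c * \<epsilon>\<^sup>2" using \<epsilon> by (intro mult_right_mono) auto
    finally show ?thesis .
  qed
  have iHL: "integrable M (\<lambda>z. H z - L z)"
    by (rule integrable_const_bound[where B = "c * \<epsilon>\<^sup>2"])
      (use iL HL in \<open>auto intro!: AE_I2 borel_measurable_diff\<close>)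
  have iH: "integrable M H"
    using Bochner_Integration.integrable_add[OF iHL iL] by simp
  have "(LINT z|M. H z) = (LINT z|M. H z - L z) + (LINT z|M. L z)"
    using iH iL by simp
  moreover have "\<bar>Re (LINT z|M. H z - L z)\<bar> \<le> c * \<epsilon>\<^sup>2"
  proof -
    have "\<bar>Re (LINT z|M. H z - L z)\<bar> \<le> norm (LINT z|M. H z - L z)"
      by (rule abs_Re_le_cmod)
    also have "\<dots> \<le> (LINT z|M. norm (H z - L z))"
      by (rule integral_norm_bound)
    also have "\<dots> \<le> (LINT z|M. c * \<epsilon>\<^sup>2)"
      using iHL HL by (intro integral_mono) auto
    finally show ?thesis by (simp add: prob_space)
  qed
  moreover have "0 \<le> (c * \<epsilon>\<^sup>2) * (2 * (LINT z|M. \<rho> z))"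
    using c e\<rho> by simp
  ultimately have EH: "Re (LINT z|M. H z) \<le> - (c * \<epsilon>\<^sup>2)"
    using EL by (simp add: algebra_simps abs_le_iff)
  \<comment> \<open>The exponent \<open>r\<close> is negative, so the lower bound
    \<open>1 / 4\<close> for \<open>X z\<close> turns into the upper bound \<open>B\<close> for
    \<open>X z powr r\<close>.\<close>
  define B where "B = (1 / 4) powr r"
  have B: "0 < B" by (simp add: B_def)
  have nuv: "norm (u z + v z) \<le> 2" if "z \<in> space M" for z
    using norm_triangle_ineq[of "u z" "v z"] u[OF that] v[OF that] by simp
  have X: "1 / 4 \<le> X z" if "z \<in> space M" for z
  proof -
    have "norm (\<epsilon> * (u z + v z)) \<le> 1 / 2"
      using mult_mono[OF \<epsilon>16 nuv[OF that]] \<epsilon>(1) by (simp add: norm_mult)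
    then have "1 / 2 \<le> norm (1 + \<epsilon> * (u z + v z))"
      using norm_triangle_ineq2[of 1 "- (\<epsilon> * (u z + v z))"] by simp
    then have "(1 / 2)\<^sup>2 \<le> X z" unfolding X_def by (intro power_mono) auto
    then show ?thesis by (simp add: power2_eq_square)
  qed
  have XB: "X z powr r \<le> B" if "z \<in> space M" for z
    unfolding B_def using X[OF that] q by (intro powr_mono2') (auto simp: r_def)
  \<comment> \<open>This value minimises \<open>- 2 * \<delta> * (c * \<epsilon>\<^sup>2) +
    \<delta>\<^sup>2 * B\<close>; the minimum is
    \<open>- \<delta> * (c * \<epsilon>\<^sup>2)\<close>.\<close>
  define \<delta> where "\<delta> = c * \<epsilon>\<^sup>2 / B"
  have \<delta>: "0 < \<delta>" "\<delta> * B = c * \<epsilon>\<^sup>2" using B c \<epsilon> by (auto simp: \<delta>_def)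
  have sq: "norm x powr (2 * q) = ((norm x)\<^sup>2) powr q" for x :: complex
    by (cases "x = 0") (simp_all add: powr_powr flip: powr_numeral)
  have ptw: "norm (1 + \<epsilon> * (u z + v z) + \<delta> * (u z * v z)) powr (2 * q)
      \<le> norm (1 + \<epsilon> * (u z + v z)) powr (2 * q) + q * (2 * \<delta> * Re (H z) + \<delta>\<^sup>2 * B)"
    if z: "z \<in> space M" for z
  proof -
    define x where "x = 1 + \<epsilon> * (u z + v z)"
    define b where "b = u z * v z"
    have nb: "norm b = 1" by (simp add: b_def norm_mult u v z)
    have "(norm (x + \<delta> * b))\<^sup>2 = (norm x)\<^sup>2 + 2 * \<delta> * Re (cnj x * b) + \<delta>\<^sup>2 * (norm b)\<^sup>2"
      unfolding cmod_power2 by (simp add: power2_eq_square algebra_simps)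
    then have Y: "(norm (x + \<delta> * b))\<^sup>2 - X z = 2 * \<delta> * Re (cnj x * b) + \<delta>\<^sup>2"
      by (simp add: nb X_def x_def)
    have ReH: "X z powr r * Re (cnj x * b) = Re (H z)"
      by (simp add: H_def x_def b_def mult.assoc)
    have "((norm (x + \<delta> * b))\<^sup>2) powr q
       \<le> X z powr q + q * X z powr (q - 1) * ((norm (x + \<delta> * b))\<^sup>2 - X z)"
      using X[OF z] q by (intro powr_le_tangent) auto
    also have "\<dots> = X z powr q + q * (2 * \<delta> * (X z powr r * Re (cnj x * b)) + \<delta>\<^sup>2 * X z powr r)"
      unfolding Y r_def by (simp add: algebra_simps)
    also have "\<dots> \<le> X z powr q + q * (2 * \<delta> * Re (H z) + \<delta>\<^sup>2 * B)"
      unfolding ReH using XB[OF z] q by (intro add_left_mono mult_left_mono) auto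
    finally show ?thesis
      by (simp add: sq X_def x_def b_def)
  qed
  have ib: "integrable M (\<lambda>z. norm (1 + \<epsilon> * (u z + v z) + t * (u z * v z)) powr (2 * q))" for t :: real
  proof (rule integrable_const_bound[where B = "(1 + \<epsilon> * 2 + \<bar>t\<bar>) powr (2 * q)"])
    have "norm (1 + \<epsilon> * (u z + v z) + t * (u z * v z)) \<le> 1 + \<epsilon> * 2 + \<bar>t\<bar>" if "z \<in> space M" for z
      using nuv[OF that] \<epsilon>(1) u[OF that] v[OF that]
      by (intro norm_triangle_mono) (auto simp: norm_mult)
    then show "AE z in M. norm (norm (1 + \<epsilon> * (u z + v z) + t * (u z * v z)) powr (2 * q)) \<le> (1 + \<epsilon> * 2 + \<bar>t\<bar>) powr (2 * q)"
      using q by (intro AE_I2) (auto intro!: powr_mono2)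
  qed measurable
  have i0: "integrable M (\<lambda>z. norm (1 + \<epsilon> * (u z + v z)) powr (2 * q))" using ib[of 0] by simp
  have "(LINT z|M. norm (1 + \<epsilon> * (u z + v z) + \<delta> * (u z * v z)) powr (2 * q))
     \<le> (LINT z|M. norm (1 + \<epsilon> * (u z + v z)) powr (2 * q) + q * (2 * \<delta> * Re (H z) + \<delta>\<^sup>2 * B))"
    using ptw ib[of \<delta>] i0 iH by (intro integral_mono) auto
  also have "\<dots> = (LINT z|M. norm (1 + \<epsilon> * (u z + v z)) powr (2 * q))
      + q * (2 * \<delta> * Re (LINT z|M. H z) + \<delta>\<^sup>2 * B)"
    using i0 iH by (simp add: prob_space)
  also have "\<dots> < (LINT z|M. norm (1 + \<epsilon> * (u z + v z)) powr (2 * q))"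
  proof -
    have "2 * \<delta> * Re (LINT z|M. H z) + \<delta>\<^sup>2 * B \<le> 2 * \<delta> * (- (c * \<epsilon>\<^sup>2)) + \<delta> * (\<delta> * B)"
      using \<delta>(1) EH by (intro add_mono mult_left_mono) (auto simp: power2_eq_square)
    also have "\<dots> = - (\<delta> * (c * \<epsilon>\<^sup>2))" using \<delta>(2) by simp
    also have "\<dots> < 0" using \<delta>(1) c \<epsilon> by simp
    finally show ?thesis using q(1) by (simp add: mult_pos_neg)
  qed
  finally show ?thesis by (rule that)
qed

section \<open>Monomials on the torus\<close>

lemma monomial_superset:
  assumes "finite S" "Poly_Mapping.keys \<alpha> \<subseteq> S"
  shows "monomial \<alpha> z = (\<Prod>j\<in>S. z j ^ Poly_Mapping.lookup \<alpha> j)"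
  unfolding monomial_def using assms
  by (intro prod.mono_neutral_left) (auto simp: in_keys_iff)

lemma monomial_add: "monomial (\<alpha> + \<beta>) z = monomial \<alpha> z * monomial \<beta> z"
proof -
  let ?S = "Poly_Mapping.keys \<alpha> \<union> Poly_Mapping.keys \<beta>"
  have "monomial (\<alpha> + \<beta>) z = (\<Prod>j\<in>?S. z j ^ Poly_Mapping.lookup (\<alpha> + \<beta>) j)"
    by (intro monomial_superset) (auto dest: subsetD[OF Poly_Mapping.keys_add])
  also have "\<dots> = (\<Prod>j\<in>?S. z j ^ Poly_Mapping.lookup \<alpha> j) * (\<Prod>j\<in>?S. z j ^ Poly_Mapping.lookup \<beta> j)"
    by (simp add: lookup_add power_add prod.distrib)
  also have "\<dots> = monomial \<alpha> z * monomial \<beta> z"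
    by (simp add: monomial_superset[symmetric])
  finally show ?thesis .
qed

lemma eval_poly_superset:
  assumes "finite S" "Poly_Mapping.keys f \<subseteq> S"
  shows "eval_poly f z = (\<Sum>\<alpha>\<in>S. Poly_Mapping.lookup f \<alpha> * monomial \<alpha> z)"
  unfolding eval_poly_def using assms
  by (intro sum.mono_neutral_left) (auto simp: in_keys_iff)

lemma eval_poly_add: "eval_poly (f + g) z = eval_poly f z + eval_poly g z"
proof -
  let ?S = "Poly_Mapping.keys f \<union> Poly_Mapping.keys g"
  have "eval_poly (f + g) z = (\<Sum>\<alpha>\<in>?S. Poly_Mapping.lookup (f + g) \<alpha> * monomial \<alpha> z)"
    by (intro eval_poly_superset) (auto dest: subsetD[OF Poly_Mapping.keys_add])
  also have "\<dots> = (\<Sum>\<alpha>\<in>?S. Poly_Mapping.lookup f \<alpha> * monomial \<alpha> z)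
      + (\<Sum>\<alpha>\<in>?S. Poly_Mapping.lookup g \<alpha> * monomial \<alpha> z)"
    by (simp add: lookup_add distrib_right sum.distrib)
  also have "\<dots> = eval_poly f z + eval_poly g z"
    by (simp add: eval_poly_superset[symmetric])
  finally show ?thesis .
qed

lemma eval_poly_single: "eval_poly (Poly_Mapping.single \<alpha> c) z = c * monomial \<alpha> z"
  by (subst eval_poly_superset[where S = "{\<alpha>}"]) auto

lemma analytic_polys_add: "f \<in> analytic_polys d \<Longrightarrow> g \<in> analytic_polys d \<Longrightarrow> f + g \<in> analytic_polys d"
  using Poly_Mapping.keys_add[of f g] by (auto simp: analytic_polys_def)

lemma analytic_polys_single: "\<alpha> \<in> multi_indices d \<Longrightarrow> Poly_Mapping.single \<alpha> c \<in> analytic_polys d"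
  by (auto simp: analytic_polys_def)

lemma multi_indices_add: "\<alpha> \<in> multi_indices d \<Longrightarrow> \<beta> \<in> multi_indices d \<Longrightarrow> \<alpha> + \<beta> \<in> multi_indices d"
  using Poly_Mapping.keys_add[of \<alpha> \<beta>] by (auto simp: multi_indices_def)

lemma measurable_monomial:
  assumes "\<alpha> \<in> multi_indices d"
  shows "monomial \<alpha> \<in> borel_measurable (torus d)"
  using eval_poly_measurable[OF analytic_polys_single[OF assms, of 1]] by (simp add: eval_poly_single[abs_def])

lemma norm_monomial:
  assumes "\<alpha> \<in> multi_indices d" "z \<in> space (torus d)"
  shows "norm (monomial \<alpha> z) = 1"
  using assms by (auto simp: monomial_def multi_indices_def space_torus norm_power PiE_iff subset_iff
      prod_norm[symmetric] intro!: prod.neutral)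

lemma monomial_rotate_torus:
  assumes "\<alpha> \<in> multi_indices d"
  shows "monomial \<alpha> (rotate_torus d c z) = monomial \<alpha> c * monomial \<alpha> z"
  using assms unfolding monomial_def rotate_torus_def multi_indices_def
  by (auto simp: power_mult_distrib subset_iff simp flip: prod.distrib intro!: prod.cong)

lemma monomial_unit:
  "monomial \<alpha> ((\<lambda>_. 1)(j := t)) = t ^ Poly_Mapping.lookup \<alpha> j"
proof -
  have "monomial \<alpha> ((\<lambda>_. 1)(j := t)) =
      (\<Prod>i\<in>insert j (Poly_Mapping.keys \<alpha>). ((\<lambda>_. 1)(j := t)) i ^ Poly_Mapping.lookup \<alpha> i)"
    by (intro monomial_superset) auto
  also have "\<dots> = t ^ Poly_Mapping.lookup \<alpha> j"
    by (subst prod.insert_remove) (auto intro!: prod.neutral)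
  finally show ?thesis .
qed

text \<open>In a coordinate where the exponents differ by \<open>k\<close>, a rotation by
  \<open>pi / k\<close> changes the sign of the integrand but preserves the integral.\<close>

lemma integral_torus_ratio_eq_0:
  assumes "\<beta> \<in> multi_indices d" "\<gamma> \<in> multi_indices d" "\<beta> \<noteq> \<gamma>"
  shows "(LINT z|torus d. monomial \<beta> z * cnj (monomial \<gamma> z)) = 0"
proof -
  note [measurable] = measurable_monomial[OF assms(1)] measurable_monomial[OF assms(2)]
  obtain j where j: "Poly_Mapping.lookup \<beta> j \<noteq> Poly_Mapping.lookup \<gamma> j"
    using assms(3) by (meson poly_mapping_eqI)
  \<comment> \<open>The difference is taken in the reals because it may be negative.\<close>
  define k :: real where "k = real (Poly_Mapping.lookup \<beta> j) - real (Poly_Mapping.lookup \<gamma> j)"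
  have "k \<noteq> 0" using j by (simp add: k_def)
  define t where "t = cis (pi / k)"
  define c where "c = ((\<lambda>_. 1)(j := t) :: nat \<Rightarrow> complex)"
  have "real (Poly_Mapping.lookup \<beta> j) * (pi / k) - real (Poly_Mapping.lookup \<gamma> j) * (pi / k) = k * (pi / k)"
    by (simp only: k_def left_diff_distrib)
  also have "\<dots> = pi" using \<open>k \<noteq> 0\<close> by simp
  finally have "t ^ Poly_Mapping.lookup \<beta> j * cnj (t ^ Poly_Mapping.lookup \<gamma> j) = -1"
    by (simp add: t_def Complex.DeMoivre cis_cnj cis_mult)
  then have "monomial \<beta> (rotate_torus d c z) * cnj (monomial \<gamma> (rotate_torus d c z))
     = - (monomial \<beta> z * cnj (monomial \<gamma> z))" for z
    by (simp add: monomial_rotate_torus assms c_def monomial_unit mult_ac)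
  moreover have "(LINT z|torus d. monomial \<beta> (rotate_torus d c z) * cnj (monomial \<gamma> (rotate_torus d c z)))
     = (LINT z|torus d. monomial \<beta> z * cnj (monomial \<gamma> z))"
    by (rule integral_rotate_torus[where F = "\<lambda>z. monomial \<beta> z * cnj (monomial \<gamma> z)"])
      (auto simp: c_def t_def)
  ultimately have "- (LINT z|torus d. monomial \<beta> z * cnj (monomial \<gamma> z))
     = (LINT z|torus d. monomial \<beta> z * cnj (monomial \<gamma> z))" by simp
  then show ?thesis by (simp add: neg_eq_iff_add_eq_0 flip: mult_2)
qed

text \<open>Powers of monomials have to be monomials again so that the orthogonality relation
  applies to them.\<close>

lemma obtain_monomial_power:
  assumes "\<alpha> \<in> multi_indices d"
  obtains \<beta> where "\<beta> \<in> multi_indices d" "\<And>z. monomial \<beta> z = monomial \<alpha> z ^ n"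
    "\<And>j. Poly_Mapping.lookup \<beta> j = n * Poly_Mapping.lookup \<alpha> j"
proof (induction n arbitrary: thesis)
  case 0
  show ?case by (rule 0[of 0]) (simp_all add: monomial_def multi_indices_def)
next
  case (Suc n)
  obtain \<beta> where "\<beta> \<in> multi_indices d" "\<And>z. monomial \<beta> z = monomial \<alpha> z ^ n"
    "\<And>j. Poly_Mapping.lookup \<beta> j = n * Poly_Mapping.lookup \<alpha> j" by (rule Suc(1)) blast
  then show ?case
    by (intro Suc(2)[of "\<alpha> + \<beta>"]) (simp_all add: monomial_add lookup_add multi_indices_add assms)
qed

text \<open>The outer root \<open>1 / p\<close> is strictly increasing on nonnegative numbers and
  can be removed.\<close>

lemma integral_powr_le_of_contraction:
  assumes "extends_to_contraction d p P" "0 < p" "f \<in> analytic_polys d"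
  shows "(LINT z|torus d. norm (eval_poly (P f) z) powr p) \<le> (LINT z|torus d. norm (eval_poly f z) powr p)"
proof (rule ccontr)
  assume "\<not> ?thesis"
  then have "(LINT z|torus d. norm (eval_poly f z) powr p) powr (1 / p)
     < (LINT z|torus d. norm (eval_poly (P f) z) powr p) powr (1 / p)"
    using assms(2) by (intro powr_less_mono2 integral_nonneg_AE) auto
  then show False using assms by (auto simp: extends_to_contraction_def Lp_quasinorm_def not_le[symmetric])
qed

section \<open>Coordinate projections are contractions\<close>

lemma contraction_of_coordinate_projection:
  assumes p: "0 < p" and J: "J \<subseteq> coords d"
  shows "extends_to_contraction d p
    (idempotent_multiplier {\<alpha> \<in> multi_indices d. \<forall>j\<in>J. Poly_Mapping.lookup \<alpha> j = 0})"
  unfolding extends_to_contraction_def Lp_quasinorm_def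
proof (intro ballI powr_mono2)
  fix f assume f: "f \<in> analytic_polys d"
  let ?\<Gamma> = "{\<alpha> \<in> multi_indices d. \<forall>j\<in>J. Poly_Mapping.lookup \<alpha> j = 0}"
  interpret C: prob_space circle_measure by (rule prob_space_circle_measure)
  interpret T: prob_space "torus d" by (rule prob_space_torus)
  interpret CT: pair_prob_space circle_measure "torus d" ..
  have mi: "\<alpha> \<in> multi_indices d" if "\<alpha> \<in> Poly_Mapping.keys f" for \<alpha>
    using f that by (auto simp: analytic_polys_def)
  \<comment> \<open>For fixed \<open>z\<close>, multiplying the coordinates in \<open>J\<close> by
    \<open>w\<close> turns \<open>f\<close> into a polynomial \<open>g z\<close> in
    \<open>w\<close>, and \<open>deg \<alpha>\<close> is the exponent of \<open>w\<close> in the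
    term of \<open>\<alpha>\<close>.\<close>
  define deg where "deg \<alpha> = (\<Sum>j\<in>J \<inter> Poly_Mapping.keys \<alpha>. Poly_Mapping.lookup \<alpha> j)" for \<alpha> :: "nat \<Rightarrow>\<^sub>0 nat"
  define r where "r w = (\<lambda>j. if j \<in> J then w else 1)" for w :: complex
  define g where "g z = (\<Sum>\<alpha>\<in>Poly_Mapping.keys f. monom (Poly_Mapping.lookup f \<alpha> * monomial \<alpha> z) (deg \<alpha>))" for z
  have mr: "monomial \<alpha> (r w) = w ^ deg \<alpha>" for \<alpha> w
    unfolding monomial_def r_def deg_def power_sum Int_commute[of J] prod.inter_restrict[OF finite_keys]
    by (intro prod.cong) auto
  have g: "poly (g z) w = eval_poly f (rotate_torus d (r w) z)" for z w
    unfolding g_def eval_poly_def poly_sum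
    by (intro sum.cong) (auto simp: poly_monom monomial_rotate_torus mi mr)
  \<comment> \<open>At \<open>w = 0\<close> exactly the terms of degree 0 remain, and these are the
    indices vanishing on \<open>J\<close>.\<close>
  have g0: "poly (g z) 0 = eval_poly (idempotent_multiplier ?\<Gamma> f) z" for z
  proof -
    have deg0: "deg \<alpha> = 0 \<longleftrightarrow> \<alpha> \<in> ?\<Gamma>" if "\<alpha> \<in> Poly_Mapping.keys f" for \<alpha>
      using mi[OF that] by (auto simp: deg_def in_keys_iff)
    have "eval_poly (idempotent_multiplier ?\<Gamma> f) z
       = (\<Sum>\<alpha>\<in>Poly_Mapping.keys f. Poly_Mapping.lookup (idempotent_multiplier ?\<Gamma> f) \<alpha> * monomial \<alpha> z)"
      by (intro eval_poly_superset) (auto simp: in_keys_iff lookup_idempotent_multiplier split: if_splits)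
    also have "\<dots> = poly (g z) 0"
      unfolding g_def poly_sum
      by (intro sum.cong) (auto simp: poly_monom power_0_left deg0 lookup_idempotent_multiplier simp del: mem_Collect_eq)
    finally show ?thesis by simp
  qed
  have nr: "norm (r w j) = 1" if "w \<in> space circle_measure" for w j
    using that by (simp add: r_def space_circle_measure)
  have mm: "(\<lambda>x. monomial \<alpha> (snd x)) \<in> borel_measurable (circle_measure \<Otimes>\<^sub>M torus d)"
    if "\<alpha> \<in> Poly_Mapping.keys f" for \<alpha>
    by (rule measurable_compose[OF measurable_snd measurable_monomial[OF mi[OF that]]])
  have mw: "fst \<in> borel_measurable (circle_measure \<Otimes>\<^sub>M torus d)"
    by (rule measurable_compose[OF measurable_fst measurable_circle_measure_imp_borel[OF measurable_ident_sets[OF refl]]])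
  have "(\<lambda>x. poly (g (snd x)) (fst x)) \<in> borel_measurable (circle_measure \<Otimes>\<^sub>M torus d)"
    unfolding g_def poly_sum poly_monom using mm mw
    by (intro borel_measurable_sum borel_measurable_times borel_measurable_const borel_measurable_power)
  note [measurable] = this
  let ?F = "\<lambda>(w, z). norm (poly (g z) w) powr p"
  let ?B = "(\<Sum>\<alpha>\<in>Poly_Mapping.keys f. norm (Poly_Mapping.lookup f \<alpha>)) powr p"
  have intF: "integrable (circle_measure \<Otimes>\<^sub>M torus d) ?F"
  proof (rule CT.integrable_const_bound[where B = ?B])
    show "AE x in circle_measure \<Otimes>\<^sub>M torus d. norm (?F x) \<le> ?B"
    proof (rule AE_I2, clarsimp simp: space_pair_measure)
      fix w z assume w: "w \<in> space circle_measure" and z: "z \<in> space (torus d)"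
      have "rotate_torus d (r w) z \<in> space (torus d)"
        by (rule measurable_space[OF measurable_rotate_torus z]) (rule nr[OF w])
      then have "norm (poly (g z) w) \<le> (\<Sum>\<alpha>\<in>Poly_Mapping.keys f. norm (Poly_Mapping.lookup f \<alpha>))"
        unfolding g by (rule eval_poly_bounded[OF f])
      then show "norm (poly (g z) w) powr p \<le> ?B"
        using p by (intro powr_mono2) auto
    qed
    show "?F \<in> borel_measurable (circle_measure \<Otimes>\<^sub>M torus d)"
      unfolding split_beta' by measurable
  qed
  have Pf: "idempotent_multiplier ?\<Gamma> f \<in> analytic_polys d"
    using f by (auto simp: analytic_polys_def in_keys_iff lookup_idempotent_multiplier subset_iff split: if_splits)
  have "(LINT z|torus d. norm (eval_poly (idempotent_multiplier ?\<Gamma> f) z) powr p)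
     \<le> (LINT z|torus d. LINT w|circle_measure. norm (poly (g z) w) powr p)"
  proof (rule integral_mono)
    show "integrable (torus d) (\<lambda>z. LINT w|circle_measure. norm (poly (g z) w) powr p)"
      using CT.integrable_snd[OF intF] by simp
  qed (use integrable_eval_poly_powr[OF Pf p] norm_poly_powr_le_integral_circle_measure[OF p] in \<open>auto simp flip: g0\<close>)
  also have "\<dots> = (LINT w|circle_measure. LINT z|torus d. norm (poly (g z) w) powr p)"
    using CT.Fubini_integral[of "\<lambda>w z. norm (poly (g z) w) powr p"] intF by simp
  \<comment> \<open>For each \<open>w\<close> on the circle the map
    \<open>rotate_torus d (r w)\<close> preserves the measure, so the inner integral does not depend
    on \<open>w\<close>.\<close>
  also have "\<dots> = (LINT w|circle_measure. LINT z|torus d. norm (eval_poly f z) powr p)"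
  proof (rule Bochner_Integration.integral_cong)
    fix w assume w: "w \<in> space circle_measure"
    show "(LINT z|torus d. norm (poly (g z) w) powr p) = (LINT z|torus d. norm (eval_poly f z) powr p)"
      unfolding g using nr[OF w] integrable_eval_poly_powr[OF f p]
      by (intro integral_rotate_torus[where F = "\<lambda>z. norm (eval_poly f z) powr p"]) auto
  qed simp
  also have "\<dots> = (LINT z|torus d. norm (eval_poly f z) powr p)"
    by (simp add: C.prob_space)
  finally show "(LINT z|torus d. norm (eval_poly (idempotent_multiplier ?\<Gamma> f) z) powr p)
    \<le> (LINT z|torus d. norm (eval_poly f z) powr p)" .
qed (use p in \<open>auto intro!: integral_nonneg_AE\<close>)

section \<open>Closure properties forced by contractivity\<close>

lemma idempotent_multiplier_add:
  "idempotent_multiplier \<Gamma> (f + g) = idempotent_multiplier \<Gamma> f + idempotent_multiplier \<Gamma> g"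
  by (rule poly_mapping_eqI) (simp add: lookup_idempotent_multiplier lookup_add)

lemma idempotent_multiplier_single:
  "idempotent_multiplier \<Gamma> (Poly_Mapping.single \<alpha> c) = (if \<alpha> \<in> \<Gamma> then Poly_Mapping.single \<alpha> c else 0)"
  by (rule poly_mapping_eqI) (auto simp: lookup_idempotent_multiplier lookup_single when_def)

text \<open>If both \<open>b\<close> and \<open>c\<close> were missing, the multiplier would reduce
  the polynomial with coefficient 1 at \<open>a\<close> and \<epsilon> at \<open>b\<close> and
  \<open>c\<close> to the monomial at \<open>a\<close>, of quasi-norm 1. Dividing by that monomial
  gives \<open>1 + \<epsilon> * (w z + cnj (w z))\<close>, whose quasi-norm is smaller for a
  suitable \<epsilon>.\<close>

lemma contraction_midpoint:
  assumes contr: "extends_to_contraction d p (idempotent_multiplier \<Gamma>)" and p: "0 < p" "p < 1"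
    and \<Gamma>: "\<Gamma> \<subseteq> multi_indices d" and a: "a \<in> \<Gamma>"
    and b: "b \<in> multi_indices d" and c: "c \<in> multi_indices d" and bc: "b + c = a + a"
  shows "b \<in> \<Gamma> \<or> c \<in> \<Gamma>"
proof (rule ccontr)
  assume n: "\<not> (b \<in> \<Gamma> \<or> c \<in> \<Gamma>)"
  interpret prob_space "torus d" by (rule prob_space_torus)
  have a': "a \<in> multi_indices d" using a \<Gamma> by blast
  note [measurable] = measurable_monomial[OF a'] measurable_monomial[OF b]
  define w where "w z = monomial b z * cnj (monomial a z)" for z
  have wm: "w \<in> borel_measurable (torus d)" unfolding w_def by measurable
  have ba: "b \<noteq> a" using n a by auto
  \<comment> \<open>Doubling is injective, so the square of \<open>w\<close> is a quotient of
    distinct monomials and integrates to 0 as well.\<close>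
  have bb: "b + b \<noteq> a + a"
  proof
    assume "b + b = a + a"
    have "b = a"
    proof (rule poly_mapping_eqI)
      fix j
      have "Poly_Mapping.lookup (b + b) j = Poly_Mapping.lookup (a + a) j"
        by (simp only: \<open>b + b = a + a\<close>)
      then show "Poly_Mapping.lookup b j = Poly_Mapping.lookup a j" by (simp add: lookup_add)
    qed
    then show False using ba by simp
  qed
  have aca: "monomial a z * cnj (monomial a z) = 1" if "z \<in> space (torus d)" for z
    using norm_monomial[OF a' that] by (simp add: complex_norm_square[symmetric])
  have nw: "norm (w z) = 1" if "z \<in> space (torus d)" for z
    using norm_monomial[OF a' that] norm_monomial[OF b that] by (simp add: w_def norm_mult)
  have mb: "monomial b z = monomial a z * w z" if "z \<in> space (torus d)" for z
    using aca[OF that] by (simp add: w_def mult.left_commute)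
  \<comment> \<open>The relation \<open>b + c = a + a\<close> says that the quotients by the
    monomial at \<open>a\<close> are inverse to each other, hence conjugate on the torus.\<close>
  have mc: "monomial c z = monomial a z * cnj (w z)" if z: "z \<in> space (torus d)" for z
  proof -
    have "monomial b z * monomial c z = monomial a z * monomial a z"
      by (simp only: bc flip: monomial_add)
    then have "monomial a z * (w z * monomial c z) = monomial a z * monomial a z"
      by (simp add: mb z mult.assoc)
    then have "w z * monomial c z = monomial a z"
      using norm_monomial[OF a' z] by auto
    moreover have "cnj (w z) * w z = 1"
      using nw[OF z] by (simp add: complex_norm_square[symmetric] mult.commute)
    ultimately show ?thesis by (metis mult.assoc mult.commute mult_1)
  qed
  have w1: "(LINT z|torus d. w z) = 0"
    unfolding w_def by (rule integral_torus_ratio_eq_0[OF b a' ba])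
  have w2: "(LINT z|torus d. (w z)\<^sup>2) = 0"
    using integral_torus_ratio_eq_0[OF multi_indices_add[OF b b] multi_indices_add[OF a' a'] bb]
    by (simp add: w_def monomial_add power2_eq_square mult_ac)
  obtain \<epsilon> :: real where \<epsilon>: "(LINT z|torus d. norm (1 + \<epsilon> * (w z + cnj (w z))) powr p) < 1"
    by (rule symmetric_perturbation_decreases[OF wm nw w1 w2 p]) blast
  define f where "f = Poly_Mapping.single a (1::complex) + Poly_Mapping.single b (complex_of_real \<epsilon>)
    + Poly_Mapping.single c (complex_of_real \<epsilon>)"
  have f: "f \<in> analytic_polys d"
    unfolding f_def by (intro analytic_polys_add analytic_polys_single a' b c)
  have Pf: "idempotent_multiplier \<Gamma> f = Poly_Mapping.single a 1"
    using n a by (simp add: f_def idempotent_multiplier_add idempotent_multiplier_single)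
  have ef: "norm (eval_poly f z) = norm (1 + \<epsilon> * (w z + cnj (w z)))" if z: "z \<in> space (torus d)" for z
  proof -
    have "eval_poly f z = monomial a z * (1 + \<epsilon> * (w z + cnj (w z)))"
      by (simp add: f_def eval_poly_add eval_poly_single mb mc z algebra_simps)
    then show ?thesis by (simp only: norm_mult norm_monomial[OF a' z])
  qed
  have "(LINT z|torus d. norm (eval_poly (Poly_Mapping.single a 1) z) powr p) = (LINT z|torus d. 1)"
    by (intro Bochner_Integration.integral_cong) (auto simp: eval_poly_single norm_monomial[OF a'])
  moreover have "(LINT z|torus d. norm (eval_poly f z) powr p)
     = (LINT z|torus d. norm (1 + \<epsilon> * (w z + cnj (w z))) powr p)"
    by (intro Bochner_Integration.integral_cong) (auto simp: ef)
  ultimately show False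
    using integral_powr_le_of_contraction[OF contr p(1) f] \<epsilon> by (simp add: Pf prob_space)
qed

text \<open>The last assumption makes \<open>u\<^sup>m v\<^sup>n\<close> integrate to \<open>0\<close> for \<open>u = z\<^sup>b / z\<^sup>a\<close> and
  \<open>v = z\<^sup>c / z\<^sup>a\<close>. It admits \<open>b = c \<noteq> a\<close> as well as \<open>a = 0\<close> with independent \<open>b\<close> and \<open>c\<close>.\<close>

lemma contraction_parallelogram:
  assumes contr: "extends_to_contraction d p (idempotent_multiplier \<Gamma>)" and p: "0 < p" "p < 1"
    and \<Gamma>: "\<Gamma> \<subseteq> multi_indices d" and abc: "a \<in> \<Gamma>" "b \<in> \<Gamma>" "c \<in> \<Gamma>"
    and e: "e \<in> multi_indices d" and bc: "a + e = b + c"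
    and nondeg: "\<And>m n. 0 < m + n \<Longrightarrow> \<exists>j. m * Poly_Mapping.lookup b j + n * Poly_Mapping.lookup c j
      \<noteq> (m + n) * Poly_Mapping.lookup a j"
  shows "e \<in> \<Gamma>"
proof (rule ccontr)
  assume n: "e \<notin> \<Gamma>"
  interpret prob_space "torus d" by (rule prob_space_torus)
  have a: "a \<in> multi_indices d" and b: "b \<in> multi_indices d" and c: "c \<in> multi_indices d"
    using abc \<Gamma> by auto
  note [measurable] = measurable_monomial[OF a] measurable_monomial[OF b] measurable_monomial[OF c]
  define u where "u z = monomial b z * cnj (monomial a z)" for z
  define v where "v z = monomial c z * cnj (monomial a z)" for z
  have um: "u \<in> borel_measurable (torus d)" and vm: "v \<in> borel_measurable (torus d)"
    unfolding u_def v_def by measurable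
  have aca: "monomial a z * cnj (monomial a z) = 1" if "z \<in> space (torus d)" for z
    using norm_monomial[OF a that] by (simp add: complex_norm_square[symmetric])
  have nu: "norm (u z) = 1" and nv: "norm (v z) = 1" if "z \<in> space (torus d)" for z
    using norm_monomial[OF a that] norm_monomial[OF b that] norm_monomial[OF c that]
    by (simp_all add: u_def v_def norm_mult)
  have mb: "monomial b z = monomial a z * u z" and mc: "monomial c z = monomial a z * v z"
    if "z \<in> space (torus d)" for z
    using aca[OF that] by (simp_all add: u_def v_def mult.left_commute)
  have me: "monomial e z = monomial a z * (u z * v z)" if z: "z \<in> space (torus d)" for z
  proof -
    have "monomial a z * monomial e z = monomial b z * monomial c z"
      by (simp only: bc flip: monomial_add)
    then have "monomial a z * monomial e z = monomial a z * (monomial a z * (u z * v z))"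
      by (simp add: mb mc z mult_ac)
    then show ?thesis using norm_monomial[OF a z] by auto
  qed
  \<comment> \<open>The product of powers is a quotient of the monomials with indices
    \<open>b' + c'\<close> and \<open>a'\<close>, which \<open>nondeg\<close> keeps
    distinct.\<close>
  have orth: "(LINT z|torus d. u z ^ m * v z ^ k) = 0" if "0 < m + k" for m k
  proof -
    obtain b' where b': "b' \<in> multi_indices d" "\<And>z. monomial b' z = monomial b z ^ m"
      "\<And>j. Poly_Mapping.lookup b' j = m * Poly_Mapping.lookup b j"
      by (rule obtain_monomial_power[OF b]) blast
    obtain c' where c': "c' \<in> multi_indices d" "\<And>z. monomial c' z = monomial c z ^ k"
      "\<And>j. Poly_Mapping.lookup c' j = k * Poly_Mapping.lookup c j"
      by (rule obtain_monomial_power[OF c]) blast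
    obtain a' where a': "a' \<in> multi_indices d" "\<And>z. monomial a' z = monomial a z ^ (m + k)"
      "\<And>j. Poly_Mapping.lookup a' j = (m + k) * Poly_Mapping.lookup a j"
      by (rule obtain_monomial_power[OF a]) blast
    have "b' + c' \<noteq> a'"
      using nondeg[OF that] by (metis a'(3) b'(3) c'(3) lookup_add)
    from integral_torus_ratio_eq_0[OF multi_indices_add[OF b'(1) c'(1)] a'(1) this]
    show ?thesis
      by (simp add: monomial_add a'(2) b'(2) c'(2) u_def v_def power_mult_distrib power_add mult_ac)
  qed
  \<comment> \<open>The integral is 1 if \<open>b = c\<close> and 0 otherwise.\<close>
  have re: "0 \<le> Re (LINT z|torus d. u z * cnj (v z))"
  proof -
    have uv: "u z * cnj (v z) = monomial b z * cnj (monomial c z)" if "z \<in> space (torus d)" for z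
    proof -
      have "u z * cnj (v z) = monomial b z * cnj (monomial c z) * (monomial a z * cnj (monomial a z))"
        by (simp add: u_def v_def mult_ac)
      then show ?thesis by (simp add: aca that)
    qed
    have eq: "(LINT z|torus d. u z * cnj (v z)) = (LINT z|torus d. monomial b z * cnj (monomial c z))"
      by (intro Bochner_Integration.integral_cong uv) auto
    show ?thesis
    proof (cases "b = c")
      case True
      have "(LINT z|torus d. u z * cnj (v z)) = (LINT z|torus d. 1)"
        using nu uv True by (intro Bochner_Integration.integral_cong)
          (auto simp: u_def v_def complex_norm_square[symmetric] norm_monomial[OF c])
      then show ?thesis by (simp add: prob_space)
    next
      case False
      then show ?thesis by (simp add: eq integral_torus_ratio_eq_0[OF b c])
    qed
  qed
  have q: "0 < p / 2" "p / 2 < 1" using p by auto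
  obtain \<epsilon> \<delta> :: real where less:
    "(LINT z|torus d. norm (1 + \<epsilon> * (u z + v z) + \<delta> * (u z * v z)) powr (2 * (p / 2)))
      < (LINT z|torus d. norm (1 + \<epsilon> * (u z + v z)) powr (2 * (p / 2)))"
    by (rule product_perturbation_decreases[OF um vm nu nv orth re q]) blast+
  define g where "g = Poly_Mapping.single a (1::complex) + Poly_Mapping.single b (complex_of_real \<epsilon>)
    + Poly_Mapping.single c (complex_of_real \<epsilon>)"
  \<comment> \<open>The multiplier removes exactly the term at \<open>e\<close>, but by the choice
    of \<delta> that term lowers the quasi-norm.\<close>
  define f where "f = g + Poly_Mapping.single e (complex_of_real \<delta>)"
  have f: "f \<in> analytic_polys d"
    unfolding f_def g_def by (intro analytic_polys_add analytic_polys_single a b c e)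
  have Pf: "idempotent_multiplier \<Gamma> f = g"
    using n abc by (simp add: f_def g_def idempotent_multiplier_add idempotent_multiplier_single)
  have g: "eval_poly g z = monomial a z * (1 + \<epsilon> * (u z + v z))" if z: "z \<in> space (torus d)" for z
    by (simp add: g_def eval_poly_add eval_poly_single mb mc z algebra_simps)
  have ng: "norm (eval_poly g z) = norm (1 + \<epsilon> * (u z + v z))" if z: "z \<in> space (torus d)" for z
    by (simp only: g z norm_mult norm_monomial[OF a z])
  have nf: "norm (eval_poly f z) = norm (1 + \<epsilon> * (u z + v z) + \<delta> * (u z * v z))"
    if z: "z \<in> space (torus d)" for z
  proof -
    have "eval_poly f z = monomial a z * (1 + \<epsilon> * (u z + v z) + \<delta> * (u z * v z))"
      by (simp add: f_def eval_poly_add eval_poly_single g me z algebra_simps)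
    then show ?thesis by (simp only: norm_mult norm_monomial[OF a z])
  qed
  have "(LINT z|torus d. norm (eval_poly g z) powr p)
     = (LINT z|torus d. norm (1 + \<epsilon> * (u z + v z)) powr p)"
    by (intro Bochner_Integration.integral_cong) (auto simp: ng)
  moreover have "(LINT z|torus d. norm (eval_poly f z) powr p)
     = (LINT z|torus d. norm (1 + \<epsilon> * (u z + v z) + \<delta> * (u z * v z)) powr p)"
    by (intro Bochner_Integration.integral_cong) (auto simp: nf)
  ultimately show False
    using integral_powr_le_of_contraction[OF contr p(1) f] less by (simp add: Pf)
qed

section \<open>From the two closure rules to supports of indices\<close>

text \<open>The midpoint rule gives \<open>b\<close> or \<open>c\<close>. If it gives some
  \<open>c\<close> different from \<open>a\<close>, the parallelogram with vertex \<open>c\<close>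
  and both neighbours equal to \<open>a\<close> has \<open>b\<close> as its opposite vertex. If
  \<open>c = a\<close>, then \<open>b = a\<close>.\<close>

lemma contraction_reflection:
  assumes contr: "extends_to_contraction d p (idempotent_multiplier \<Gamma>)" and p: "0 < p" "p < 1"
    and \<Gamma>: "\<Gamma> \<subseteq> multi_indices d" and a: "a \<in> \<Gamma>"
    and b: "b \<in> multi_indices d" and c: "c \<in> multi_indices d" and bc: "b + c = a + a"
  shows "b \<in> \<Gamma>"
proof (cases "c \<in> \<Gamma> \<and> c \<noteq> a")
  case True
  show ?thesis
  proof (rule contraction_parallelogram[OF contr p \<Gamma>, where a = c and b = a and c = a])
    fix m n :: nat assume mn: "0 < m + n"
    obtain j where "Poly_Mapping.lookup a j \<noteq> Poly_Mapping.lookup c j"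
      using True by (metis poly_mapping_eqI)
    then show "\<exists>j. m * Poly_Mapping.lookup a j + n * Poly_Mapping.lookup a j \<noteq> (m + n) * Poly_Mapping.lookup c j"
      using mn by (intro exI[of _ j]) (simp flip: distrib_right)
  qed (use True a b bc in \<open>auto simp: add.commute\<close>)
next
  case False
  then show ?thesis
    using contraction_midpoint[OF contr p \<Gamma> a b c bc] a bc by auto
qed

text \<open>The reflection of \<open>b\<close> in \<open>a\<close> is \<open>a + a - b\<close>. The
  bound on \<open>b\<close> ensures that no coordinate of this subtraction is truncated.\<close>

lemma contraction_le_double:
  assumes contr: "extends_to_contraction d p (idempotent_multiplier \<Gamma>)" and p: "0 < p" "p < 1"
    and \<Gamma>: "\<Gamma> \<subseteq> multi_indices d" and a: "a \<in> \<Gamma>"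
    and b: "\<And>j. Poly_Mapping.lookup b j \<le> 2 * Poly_Mapping.lookup a j"
  shows "b \<in> \<Gamma>"
proof (rule contraction_reflection[OF contr p \<Gamma> a])
  have ka: "Poly_Mapping.lookup a j = 0" if "j \<notin> coords d" for j
    using that a \<Gamma> by (auto simp: multi_indices_def in_keys_iff subset_iff)
  have "Poly_Mapping.lookup b j = 0" if "j \<notin> coords d" for j
    using b[of j] ka[OF that] by simp
  then show "b \<in> multi_indices d" by (auto simp: multi_indices_def in_keys_iff)
  show "a + a - b \<in> multi_indices d"
    using ka by (auto simp: multi_indices_def in_keys_iff lookup_add lookup_minus intro: ccontr)
  show "b + (a + a - b) = a + a"
    by (rule poly_mapping_eqI) (use b in \<open>simp add: lookup_add lookup_minus mult_2\<close>)
qed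

text \<open>The double \<open>a + a\<close> satisfies the bound of
  \<open>contraction_le_double\<close>, so it lies in \<Gamma> and the doubling can be
  iterated.\<close>

lemma contraction_le_power:
  assumes contr: "extends_to_contraction d p (idempotent_multiplier \<Gamma>)" and p: "0 < p" "p < 1"
    and \<Gamma>: "\<Gamma> \<subseteq> multi_indices d" and a: "a \<in> \<Gamma>"
    and b: "\<And>j. Poly_Mapping.lookup b j \<le> 2 ^ n * Poly_Mapping.lookup a j"
  shows "b \<in> \<Gamma>"
  using a b
proof (induction n arbitrary: a)
  case 0
  show ?case
    by (rule contraction_le_double[OF contr p \<Gamma> 0(1)]) (use 0(2) in \<open>simp add: trans_le_add1 mult_2\<close>)
next
  case (Suc n)
  have "a + a \<in> \<Gamma>"
    by (rule contraction_le_double[OF contr p \<Gamma> Suc(2)]) (simp add: lookup_add)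
  then show ?case
  proof (rule Suc(1))
    show "Poly_Mapping.lookup b j \<le> 2 ^ n * Poly_Mapping.lookup (a + a) j" for j
      using Suc(3)[of j] unfolding lookup_add by (simp add: algebra_simps)
  qed
qed

lemma contraction_keys_subset:
  assumes contr: "extends_to_contraction d p (idempotent_multiplier \<Gamma>)" and p: "0 < p" "p < 1"
    and \<Gamma>: "\<Gamma> \<subseteq> multi_indices d" and a: "a \<in> \<Gamma>"
    and b: "Poly_Mapping.keys b \<subseteq> Poly_Mapping.keys a"
  shows "b \<in> \<Gamma>"
proof (rule contraction_le_power[OF contr p \<Gamma> a])
  fix j
  \<comment> \<open>The sum dominates every entry of \<open>b\<close> and is itself below
    \<open>2 ^ ?n\<close>, while the entries of \<open>a\<close> on the support of \<open>b\<close>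
    are at least 1.\<close>
  let ?n = "\<Sum>i\<in>Poly_Mapping.keys b. Poly_Mapping.lookup b i"
  show "Poly_Mapping.lookup b j \<le> 2 ^ ?n * Poly_Mapping.lookup a j"
  proof (cases "j \<in> Poly_Mapping.keys b")
    case True
    then have "Poly_Mapping.lookup b j \<le> ?n" by (intro member_le_sum) auto
    also have "?n \<le> 2 ^ ?n" by (rule less_imp_le) (rule less_exp)
    also have "2 ^ ?n * 1 \<le> 2 ^ ?n * Poly_Mapping.lookup a j"
      using subsetD[OF b True] by (intro mult_left_mono) (auto simp: in_keys_iff)
    finally show ?thesis by simp
  qed (simp add: in_keys_iff)
qed

text \<open>The support of \<open>b\<close> is finite, so it suffices to find one element of
  \<Gamma> whose support covers it. Such an element is built by adding unit indices one coordinate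
  at a time.\<close>

lemma contraction_keys_subset_Union:
  assumes contr: "extends_to_contraction d p (idempotent_multiplier \<Gamma>)" and p: "0 < p" "p < 1"
    and \<Gamma>: "\<Gamma> \<subseteq> multi_indices d" "\<Gamma> \<noteq> {}"
    and b: "Poly_Mapping.keys b \<subseteq> (\<Union>a\<in>\<Gamma>. Poly_Mapping.keys a)"
  shows "b \<in> \<Gamma>"
proof -
  note keys_subset = contraction_keys_subset[OF contr p \<Gamma>(1)]
  have zero: "0 \<in> \<Gamma>" using \<Gamma>(2) keys_subset by fastforce
  have "\<exists>a\<in>\<Gamma>. K \<subseteq> Poly_Mapping.keys a"
    if "finite K" "K \<subseteq> (\<Union>a\<in>\<Gamma>. Poly_Mapping.keys a)" for K
    using that
  proof (induction K)
    case empty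
    then show ?case using \<Gamma>(2) by auto
  next
    case (insert j K)
    then obtain a where a: "a \<in> \<Gamma>" "K \<subseteq> Poly_Mapping.keys a" by auto
    define s where "s = Poly_Mapping.single j (1::nat)"
    have s: "s \<in> \<Gamma>" using insert(4) keys_subset[of _ s] by (auto simp: s_def)
    show ?case
    \<comment> \<open>The case \<open>a = 0\<close> is split off because the parallelogram with
      neighbours \<open>a\<close> and \<open>s\<close> of 0 would be degenerate; there
      \<open>K\<close> is empty and \<open>s\<close> itself serves.\<close>
    proof (cases "j \<in> Poly_Mapping.keys a \<or> a = 0")
      case True
      then show ?thesis
      proof
        assume "a = 0"
        then have "insert j K \<subseteq> Poly_Mapping.keys s" using a by (auto simp: s_def)
        then show ?thesis using s by blast
      qed (use a in blast)
    next
      case False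
      then obtain i where i: "i \<in> Poly_Mapping.keys a" by (auto simp: keys_eq_empty[symmetric] simp del: keys_eq_empty)
      \<comment> \<open>In the parallelogram 0, \<open>a\<close>, \<open>s\<close>,
        \<open>a + s\<close>, a combination of \<open>a\<close> and \<open>s\<close> with
        multiplicities \<open>m\<close> and \<open>n\<close> is nonzero at \<open>i\<close> if
        \<open>m\<close> is positive, and at \<open>j\<close> otherwise.\<close>
      have "a + s \<in> \<Gamma>"
      proof (rule contraction_parallelogram[OF contr p \<Gamma>(1) zero a(1) s])
        show "a + s \<in> multi_indices d" using a(1) s \<Gamma>(1) by (intro multi_indices_add) auto
        fix m n :: nat assume "0 < m + n"
        then consider "0 < m" | "m = 0" "0 < n" by linarith
        then show "\<exists>k. m * Poly_Mapping.lookup a k + n * Poly_Mapping.lookup s k \<noteq> (m + n) * Poly_Mapping.lookup 0 k"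
        proof cases
          case 1
          then show ?thesis using i by (intro exI[of _ i]) (simp add: in_keys_iff)
        next
          case 2
          then show ?thesis by (intro exI[of _ j]) (simp add: s_def)
        qed
      qed simp
      moreover have "insert j K \<subseteq> Poly_Mapping.keys (a + s)"
        using a(2) by (auto simp: in_keys_iff lookup_add s_def)
      ultimately show ?thesis by blast
    qed
  qed
  from this[OF finite_keys b] show ?thesis using keys_subset by blast
qed

theorem theorem1p4:
  fixes p :: real and d :: enat and \<Gamma> :: "(nat \<Rightarrow>\<^sub>0 nat) set"
  assumes "0 < p" and "p < 1" and "1 \<le> d"
    and "\<Gamma> \<subseteq> multi_indices d" and "\<Gamma> \<noteq> {}"
  shows "extends_to_contraction d p (idempotent_multiplier \<Gamma>) \<longleftrightarrow>
    (\<exists>J \<subseteq> coords d. \<Gamma> = {\<alpha> \<in> multi_indices d. \<forall>j\<in>J. Poly_Mapping.lookup \<alpha> j = 0})"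
proof
  assume contr: "extends_to_contraction d p (idempotent_multiplier \<Gamma>)"
  \<comment> \<open>These are the coordinates at which every element of \<Gamma> vanishes, so the
    complement of \<open>J\<close> in \<open>coords d\<close> is the union of the supports.\<close>
  define J where "J = coords d - (\<Union>a\<in>\<Gamma>. Poly_Mapping.keys a)"
  have "\<Gamma> = {\<alpha> \<in> multi_indices d. \<forall>j\<in>J. Poly_Mapping.lookup \<alpha> j = 0}"
  proof (intro equalityI subsetI)
    fix \<alpha> assume "\<alpha> \<in> \<Gamma>"
    then show "\<alpha> \<in> {\<alpha> \<in> multi_indices d. \<forall>j\<in>J. Poly_Mapping.lookup \<alpha> j = 0}"
      using assms(4) by (auto simp: J_def in_keys_iff)
  next
    fix \<alpha> assume \<alpha>: "\<alpha> \<in> {\<alpha> \<in> multi_indices d. \<forall>j\<in>J. Poly_Mapping.lookup \<alpha> j = 0}"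
    have "j \<notin> J" if "j \<in> Poly_Mapping.keys \<alpha>" for j
      using that \<alpha> by (auto simp: in_keys_iff)
    then have "Poly_Mapping.keys \<alpha> \<subseteq> (\<Union>a\<in>\<Gamma>. Poly_Mapping.keys a)"
      using \<alpha> by (auto simp: J_def multi_indices_def)
    then show "\<alpha> \<in> \<Gamma>"
      by (rule contraction_keys_subset_Union[OF contr assms(1,2,4,5)])
  qed
  moreover have "J \<subseteq> coords d" unfolding J_def by (rule Diff_subset)
  ultimately show "\<exists>J \<subseteq> coords d. \<Gamma> = {\<alpha> \<in> multi_indices d. \<forall>j\<in>J. Poly_Mapping.lookup \<alpha> j = 0}"
    by blast
next
  assume "\<exists>J \<subseteq> coords d. \<Gamma> = {\<alpha> \<in> multi_indices d. \<forall>j\<in>J. Poly_Mapping.lookup \<alpha> j = 0}"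
  then obtain J where J: "J \<subseteq> coords d"
    and \<Gamma>: "\<Gamma> = {\<alpha> \<in> multi_indices d. \<forall>j\<in>J. Poly_Mapping.lookup \<alpha> j = 0}" by blast
  show "extends_to_contraction d p (idempotent_multiplier \<Gamma>)"
    unfolding \<Gamma> by (rule contraction_of_coordinate_projection[OF assms(1) J])
qed

end
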